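(* Let $(X_i)_{i\ge1}$ be i.i.d. real random variables on a probability space $(\Omega,\mathcal F,\mathbb P)$, let $S_0:=0$ and $S_n:=X_1+\cdots+X_n$ for $n\ge1$, and assume the walk $(S_n)$ is recurrent and that there are positive reals $A_n$ such that $S_n/A_n$ converges in distribution to a stable random variable $X$ of index $\alpha$ (so that $\alpha\in[1,2]$, $(A_n)$ is regularly varying of index $1/\alpha$ and $\sum_{n\ge1}1/A_n=\infty$). Assume the Cramér condition $\limsup_{|t|\to\infty}|\mathbb E[e^{itX_1}]|<1$. Let $\beta\in[2,\infty]$ be defined by $\frac1\alpha+\frac1\beta=1$, let $\Omega^*:=\{S_n\ne0\ \forall n\ge1\}$, and for $\varepsilon>0$ let $\tilde\tau_\varepsilon:=\min\{n\ge1: |S_n|<\varepsilon\}$. Then \[ \lim_{\varepsilon\to0}\frac{\log\tilde\tau_\varepsilon}{\log\varepsilon}=-\beta\quad\text{almost surely on }\Omega^*. \]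
   Context: Under these assumptions $\mathbb P(\Omega^* )>0$. For $\beta=\infty$ the conclusion reads $\log\tilde\tau_\varepsilon/\log\varepsilon\to-\infty$. *)

theory Defs
  imports "HOL-Probability.Probability"
begin

text \<open>Characteristic function of a (non-degenerate) stable law of index alpha in (0,2],
  with location gamma, scale c > 0 and skewness b in [-1,1].\<close>
definition stable_char :: "real \<Rightarrow> real \<Rightarrow> real \<Rightarrow> real \<Rightarrow> real \<Rightarrow> complex" where
  "stable_char \<alpha> \<gamma> c b t =
     (if \<alpha> = 1 then
        exp (\<i> * complex_of_real (\<gamma> * t) - complex_of_real (c * \<bar>t\<bar>) *
             (1 + \<i> * complex_of_real (b * (2 / pi) * sgn t * ln \<bar>t\<bar>)))
      else
        exp (\<i> * complex_of_real (\<gamma> * t) - complex_of_real (c * \<bar>t\<bar> powr \<alpha>) *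
             (1 - \<i> * complex_of_real (b * sgn t * tan (pi * \<alpha> / 2)))))"

definition stable_law :: "real \<Rightarrow> real measure \<Rightarrow> bool" where
  "stable_law \<alpha> \<mu> \<longleftrightarrow> real_distribution \<mu> \<and> 0 < \<alpha> \<and> \<alpha> \<le> 2 \<and>
     (\<exists>\<gamma> c b. 0 < c \<and> \<bar>b\<bar> \<le> 1 \<and> (\<forall>t. char \<mu> t = stable_char \<alpha> \<gamma> c b t))"

definition walk_recurrent :: "'a measure \<Rightarrow> (nat \<Rightarrow> 'a \<Rightarrow> real) \<Rightarrow> bool" where
  "walk_recurrent M S \<longleftrightarrow> (AE \<omega> in M. \<forall>\<epsilon>>0. \<exists>\<^sub>\<infinity>n. \<bar>S n \<omega>\<bar> < \<epsilon>)"

definition conj_exp :: "real \<Rightarrow> ereal" where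
  "conj_exp \<alpha> = (if \<alpha> = 1 then \<infinity> else ereal (\<alpha> / (\<alpha> - 1)))"

definition hit_time :: "(nat \<Rightarrow> 'a \<Rightarrow> real) \<Rightarrow> real \<Rightarrow> 'a \<Rightarrow> nat" where
  "hit_time S \<epsilon> \<omega> = (LEAST n. 1 \<le> n \<and> \<bar>S n \<omega>\<bar> < \<epsilon>)"

end

theory Submission
  imports Defs "HOL-Real_Asymp.Real_Asymp"
begin

text \<open>
  Write \<open>b = 1 - 1 / \<alpha>\<close>, the reciprocal of the conjugate exponent. The modulus \<open>f\<close> of the
  characteristic function of a step satisfies \<open>f (u / A n) ^ n \<longlonglongrightarrow> exp (- c * u powr \<alpha>)\<close>
  uniformly on compacts, which makes \<open>- ln f\<close> regularly varying of index \<open>\<alpha>\<close> at \<open>0\<close> and gives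
  \<open>A n \<le> n powr (1 / \<alpha> + \<eta>)\<close> eventually.

  Lower bound on the hitting time: testing against a Gaussian bounds the probability of
  \<open>\<bar>S n\<bar> < \<epsilon>\<close> by an average of \<open>f ^ n\<close>, which the Cramer condition bounds by
  \<open>\<epsilon> * n powr (- 1 / \<alpha> + \<eta>)\<close> up to a summable error not depending on \<open>\<epsilon>\<close>. By Borel-Cantelli,
  almost surely \<open>\<bar>S n\<bar> \<ge> n powr - \<theta>\<close> eventually, for each \<open>\<theta> > b\<close>. For \<open>\<alpha> < 1\<close> one may take
  \<open>\<theta> = 0\<close>, contradicting recurrence.

  Upper bound: cut the line into cells of length \<open>\<epsilon>\<close>. Among the times up to \<open>n\<close> that are followed
  by \<open>n\<close> steps without an \<open>\<epsilon>\<close>-return, each cell is visited at most once. As the walk stays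
  within \<open>n powr (1 / \<alpha> + \<eta>)\<close> at most times, the probability of avoiding the \<open>\<epsilon>\<close>-ball up to
  time \<open>n\<close> is of order at most \<open>n powr (1 / \<alpha> + \<eta> - 1) / \<epsilon>\<close>, and Borel-Cantelli along \<open>n = 2 ^ i\<close>,
  \<open>\<epsilon> = n powr - \<theta>\<close> with \<open>\<theta> < b\<close> finishes the proof.
\<close>

section \<open>Characteristic functions and small balls\<close>

text \<open>Rotate by a unit \<open>w\<close> so that \<open>w * char M t\<close> is real; then
  \<open>C x = Re (w * iexp (t * x))\<close> has mean \<open>cmod (char M t)\<close>. The
  double-angle formula turns \<open>Re (w * w * iexp (2 * t * x))\<close> into
  \<open>2 * (C x)\<^sup>2 - 1\<close>, and the variance of \<open>C\<close> is nonnegative.\<close>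

lemma (in real_distribution) cmod_char_double:
  "2 * (cmod (char M t))\<^sup>2 - 1 \<le> cmod (char M (2 * t))"
proof -
  define w where "w = cis (- Arg (char M t))"
  define C where "C x = Re (w * iexp (t * x))" for x
  have w1: "cmod w = 1" by (simp add: w_def)
  have wt: "w * char M t = of_real (cmod (char M t))"
  proof -
    have "w * char M t = w * (of_real (cmod (char M t)) * cis (Arg (char M t)))"
      using rcis_cmod_Arg[of "char M t"] by (simp add: rcis_def)
    also have "\<dots> = of_real (cmod (char M t)) * (w * cis (Arg (char M t)))"
      by simp
    also have "w * cis (Arg (char M t)) = 1"
      by (simp add: w_def cis_mult)
    finally show ?thesis by simp
  qed
  have int1: "integrable M (\<lambda>x. w * iexp (s * x))" for s
    by (intro integrable_mult_right integrable_iexp) auto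
  have Cmeas [measurable]: "C \<in> borel_measurable M"
    unfolding C_def by measurable
  have Cb: "\<bar>C x\<bar> \<le> 1" for x
    unfolding C_def by (rule order_trans[OF abs_Re_le_cmod]) (simp add: norm_mult w1 del: of_real_mult)
  have intC: "integrable M C"
    using Cb by (intro integrable_const_bound[of _ 1]) auto
  have intC2: "integrable M (\<lambda>x. (C x)\<^sup>2)"
    using Cb by (intro integrable_const_bound[of _ 1]) (auto simp: abs_square_le_1)
  have m: "(\<integral>x. C x \<partial>M) = cmod (char M t)"
    unfolding C_def using wt int1[of t]
    by (subst integral_Re) (auto simp: char_def)
  have sq: "Re (w * w * iexp (2 * t * x)) = 2 * (C x)\<^sup>2 - 1" for x
  proof -
    define z where "z = w * iexp (t * x)"
    have z1: "(Re z)\<^sup>2 + (Im z)\<^sup>2 = 1"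
    proof -
      have "cmod z = 1" by (simp add: z_def norm_mult w1 del: of_real_mult)
      then show ?thesis by (simp add: cmod_def)
    qed
    have "iexp (2 * t * x) = iexp (t * x) * iexp (t * x)"
      by (simp add: exp_add[symmetric] algebra_simps)
    then have "w * w * iexp (2 * t * x) = z * z" by (simp add: z_def)
    then have "Re (w * w * iexp (2 * t * x)) = (Re z)\<^sup>2 - (Im z)\<^sup>2"
      by (simp add: power2_eq_square)
    with z1 show ?thesis by (simp add: C_def z_def)
  qed
  have "0 \<le> (\<integral>x. (C x - cmod (char M t))\<^sup>2 \<partial>M)" by simp
  also have "\<dots> = (\<integral>x. (C x)\<^sup>2 \<partial>M) - (cmod (char M t))\<^sup>2"
    using variance_eq[OF intC intC2] m by simp
  finally have "2 * (cmod (char M t))\<^sup>2 - 1 \<le> 2 * (\<integral>x. (C x)\<^sup>2 \<partial>M) - 1"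
    by simp
  also have "\<dots> = (\<integral>x. 2 * (C x)\<^sup>2 - 1 \<partial>M)"
    using intC2 prob_space by simp
  also have "\<dots> = (\<integral>x. Re (w * w * iexp (2 * t * x)) \<partial>M)" by (simp only: sq)
  also have "\<dots> = Re (w * w * char M (2 * t))"
    using int1[of "2 * t"] integrable_mult_right[OF int1[of "2*t"], of w]
    by (subst integral_Re) (auto simp: char_def mult.assoc)
  also have "\<dots> \<le> cmod (w * w * char M (2 * t))" by (rule complex_Re_le_cmod)
  finally show ?thesis by (simp add: norm_mult w1)
qed

text \<open>Read from \<open>2 * t\<close> down to \<open>t\<close>, the doubling inequality turns a
  bound \<open>\<rho>\<close> valid for \<open>T / 2 ^ k \<le> \<bar>t\<bar>\<close> into
  \<open>sqrt ((1 + \<rho>) / 2)\<close>, still below 1, on a range reaching halfway closer to 0.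
  Finitely many halvings carry the Cramer bound from infinity down to
  \<open>\<delta>\<close>.\<close>

lemma (in real_distribution) cramer_away_from_0:
  assumes "Limsup at_infinity (\<lambda>t. ereal (cmod (char M t))) < 1" and "0 < \<delta>"
  obtains \<rho> where "0 < \<rho>" "\<rho> < 1" "\<And>t. \<delta> \<le> \<bar>t\<bar> \<Longrightarrow> cmod (char M t) \<le> \<rho>"
proof -
  obtain \<rho>0 where \<rho>0: "Limsup at_infinity (\<lambda>t. ereal (cmod (char M t))) < ereal \<rho>0" "\<rho>0 < 1"
    using ereal_dense2[OF assms(1)] by auto
  have "eventually (\<lambda>t. ereal (cmod (char M t)) < ereal \<rho>0) at_infinity"
    using \<rho>0(1) by (rule Limsup_lessD)
  then obtain T where T: "\<And>t. T \<le> \<bar>t\<bar> \<Longrightarrow> cmod (char M t) < \<rho>0"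
    by (auto simp: eventually_at_infinity)
  have step: "\<exists>\<rho><1. \<forall>t. T / 2 ^ k \<le> \<bar>t\<bar> \<longrightarrow> cmod (char M t) \<le> \<rho>" for k
  proof (induction k)
    case 0
    show ?case using T \<rho>0 by (intro exI[of _ \<rho>0]) (auto intro: less_imp_le)
  next
    case (Suc k)
    then obtain \<rho> where \<rho>: "\<rho> < 1" "\<And>t. T / 2 ^ k \<le> \<bar>t\<bar> \<Longrightarrow> cmod (char M t) \<le> \<rho>" by auto
    show ?case
    proof (intro exI conjI allI impI)
      show "sqrt ((1 + \<rho>) / 2) < 1" using \<rho>(1) by simp
      fix t assume "T / 2 ^ Suc k \<le> \<bar>t\<bar>"
      then have "T / 2 ^ k \<le> \<bar>2 * t\<bar>" by (simp add: abs_mult)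
      from \<rho>(2)[OF this] cmod_char_double[of t]
      have "(cmod (char M t))\<^sup>2 \<le> (1 + \<rho>) / 2" by simp
      then show "cmod (char M t) \<le> sqrt ((1 + \<rho>) / 2)" by (rule real_le_rsqrt)
    qed
  qed
  obtain k :: nat where k: "T / \<delta> < 2 ^ k" using real_arch_pow[of 2 "T / \<delta>"] by auto
  obtain \<rho> where \<rho>: "\<rho> < 1" "\<And>t. T / 2 ^ k \<le> \<bar>t\<bar> \<Longrightarrow> cmod (char M t) \<le> \<rho>" using step by blast
  have "T / 2 ^ k \<le> \<delta>" using k assms(2) by (simp add: field_simps)
  \<comment> \<open>The maximum with 1/2 secures positivity, as the induction yields no lower bound
    on \<open>\<rho>\<close>.\<close>
  then show ?thesis
    using \<rho> by (intro that[of "max \<rho> (1/2)"]) (auto simp: le_max_iff_disj)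
qed

text \<open>Couple the laws by Skorohod. For \<open>t\<close> in the interval the two exponentials
  differ by at most \<open>min 2 (\<bar>K\<bar> * \<bar>Y n x - Z x\<bar>)\<close>, which does not
  depend on \<open>t\<close>, so dominated convergence gives uniformity.\<close>

lemma weak_conv_imp_char_uniform_limit:
  fixes \<mu> :: "nat \<Rightarrow> real measure"
  assumes \<mu>: "\<And>n. real_distribution (\<mu> n)" and M: "real_distribution M" and wc: "weak_conv_m \<mu> M"
  shows "uniform_limit {-K..K} (\<lambda>n. char (\<mu> n)) (char M) sequentially"
proof -
  obtain \<Omega> :: "real measure" and Y and Z where
    "prob_space \<Omega>" and
    Y[measurable]: "\<And>n. Y n \<in> borel_measurable \<Omega>" and
    dY: "\<And>n. distr \<Omega> borel (Y n) = \<mu> n" and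
    Z[measurable]: "Z \<in> borel_measurable \<Omega>" and
    dZ: "distr \<Omega> borel Z = M" and
    YZ: "\<And>x. x \<in> space \<Omega> \<Longrightarrow> (\<lambda>n. Y n x) \<longlonglongrightarrow> Z x"
    using Skorohod[OF \<mu> M wc] by force
  interpret prob_space \<Omega> by fact
  have D_lim: "(\<lambda>n. \<integral>x. min 2 (\<bar>K\<bar> * \<bar>Y n x - Z x\<bar>) \<partial>\<Omega>) \<longlonglongrightarrow> (\<integral>x. 0 \<partial>\<Omega>)"
  proof (rule integral_dominated_convergence[where w="\<lambda>_. 2"])
    show "AE x in \<Omega>. (\<lambda>n. min 2 (\<bar>K\<bar> * \<bar>Y n x - Z x\<bar>)) \<longlonglongrightarrow> 0"
    proof (rule AE_I2)
      fix x assume "x \<in> space \<Omega>"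
      from tendsto_diff[OF YZ[OF this] tendsto_const[of "Z x"]]
      have "(\<lambda>n. Y n x - Z x) \<longlonglongrightarrow> 0" by simp
      then have "(\<lambda>n. min 2 (\<bar>K\<bar> * \<bar>Y n x - Z x\<bar>)) \<longlonglongrightarrow> min 2 (\<bar>K\<bar> * \<bar>0\<bar>)"
        by (intro tendsto_intros)
      then show "(\<lambda>n. min 2 (\<bar>K\<bar> * \<bar>Y n x - Z x\<bar>)) \<longlonglongrightarrow> 0" by simp
    qed
  qed auto
  have bound: "cmod (char (\<mu> n) t - char M t) \<le> (\<integral>x. min 2 (\<bar>K\<bar> * \<bar>Y n x - Z x\<bar>) \<partial>\<Omega>)"
    if t: "t \<in> {-K..K}" for n t
  proof -
    have int: "integrable \<Omega> (\<lambda>x. iexp (t * Y n x))" "integrable \<Omega> (\<lambda>x. iexp (t * Z x))"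
      by (intro integrable_iexp; simp)+
    have "char (\<mu> n) t - char M t = (\<integral>x. iexp (t * Y n x) - iexp (t * Z x) \<partial>\<Omega>)"
      using int by (simp add: char_def integral_distr dY[symmetric] dZ[symmetric] del: of_real_mult)
    also have "cmod \<dots> \<le> (\<integral>x. cmod (iexp (t * Y n x) - iexp (t * Z x)) \<partial>\<Omega>)"
      by (rule integral_norm_bound)
    also have "\<dots> \<le> (\<integral>x. min 2 (\<bar>K\<bar> * \<bar>Y n x - Z x\<bar>) \<partial>\<Omega>)"
    proof (intro integral_mono)
      fix x
      have "cmod (iexp (t * Y n x) - iexp (t * Z x)) \<le> 2"
        by (rule order_trans[OF norm_triangle_ineq4]) (simp del: of_real_mult)
      moreover have "cmod (iexp (t * Y n x) - iexp (t * Z x)) \<le> \<bar>K\<bar> * \<bar>Y n x - Z x\<bar>"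
      proof -
        have "iexp (t * Y n x) - iexp (t * Z x) = iexp (t * Z x) * (iexp (t * (Y n x - Z x)) - 1)"
          by (simp add: algebra_simps exp_add[symmetric])
        then have "cmod (iexp (t * Y n x) - iexp (t * Z x)) = cmod (iexp (t * (Y n x - Z x)) - 1)"
          by (simp add: norm_mult del: of_real_mult of_real_diff)
        also have "\<dots> \<le> \<bar>t * (Y n x - Z x)\<bar>"
          using iexp_approx1[of "t * (Y n x - Z x)" 0] by simp
        also have "\<dots> \<le> \<bar>K\<bar> * \<bar>Y n x - Z x\<bar>"
          using t by (auto simp: abs_mult intro!: mult_right_mono)
        finally show ?thesis .
      qed
      ultimately show "cmod (iexp (t * Y n x) - iexp (t * Z x)) \<le> min 2 (\<bar>K\<bar> * \<bar>Y n x - Z x\<bar>)"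
        by simp
    next
      show "integrable \<Omega> (\<lambda>x. cmod (iexp (t * Y n x) - iexp (t * Z x)))"
        using int by (intro integrable_norm Bochner_Integration.integrable_diff)
      show "integrable \<Omega> (\<lambda>x. min 2 (\<bar>K\<bar> * \<bar>Y n x - Z x\<bar>))"
        by (intro integrable_const_bound[of _ 2]) auto
    qed
    finally show ?thesis .
  qed
  show ?thesis
  proof (rule uniform_limitI)
    fix e :: real assume "0 < e"
    then have "eventually (\<lambda>n. (\<integral>x. min 2 (\<bar>K\<bar> * \<bar>Y n x - Z x\<bar>) \<partial>\<Omega>) < e) sequentially"
      using order_tendstoD(2)[OF D_lim] by simp
    then show "eventually (\<lambda>n. \<forall>t\<in>{-K..K}. dist (char (\<mu> n) t) (char M t) < e) sequentially"
      by eventually_elim (auto simp: dist_norm intro: le_less_trans[OF bound])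
  qed
qed

text \<open>A form of tightness: in the same coupling \<open>\<bar>Y n x\<bar>\<close> is eventually
  below \<open>\<bar>Z x\<bar> + 1\<close>, whereas \<open>K n\<close> diverges.\<close>

lemma weak_conv_imp_prob_abs_le_tendsto_1:
  fixes \<mu> :: "nat \<Rightarrow> real measure"
  assumes \<mu>: "\<And>n. real_distribution (\<mu> n)" and M: "real_distribution M" and wc: "weak_conv_m \<mu> M"
    and K: "filterlim K at_top sequentially"
  shows "(\<lambda>n. measure (\<mu> n) {x. \<bar>x\<bar> \<le> K n}) \<longlonglongrightarrow> 1"
proof -
  obtain \<Omega> :: "real measure" and Y and Z where
    "prob_space \<Omega>" and
    Y[measurable]: "\<And>n. Y n \<in> borel_measurable \<Omega>" and
    dY: "\<And>n. distr \<Omega> borel (Y n) = \<mu> n" and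
    Z[measurable]: "Z \<in> borel_measurable \<Omega>" and
    dZ: "distr \<Omega> borel Z = M" and
    YZ: "\<And>x. x \<in> space \<Omega> \<Longrightarrow> (\<lambda>n. Y n x) \<longlonglongrightarrow> Z x"
    using Skorohod[OF \<mu> M wc] by force
  interpret prob_space \<Omega> by fact
  have "(\<lambda>n. \<integral>x. indicator {x. \<bar>x\<bar> \<le> K n} (Y n x) \<partial>\<Omega>) \<longlonglongrightarrow> (\<integral>x. (1::real) \<partial>\<Omega>)"
  proof (rule integral_dominated_convergence[where w="\<lambda>_. 1"])
    show "AE x in \<Omega>. (\<lambda>n. indicator {x. \<bar>x\<bar> \<le> K n} (Y n x)) \<longlonglongrightarrow> (1::real)"
    proof (rule AE_I2)
      fix x assume x: "x \<in> space \<Omega>"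
      have "eventually (\<lambda>n. \<bar>Y n x\<bar> < \<bar>Z x\<bar> + 1) sequentially"
        using tendsto_rabs[OF YZ[OF x]] by (rule order_tendstoD) simp
      moreover have "eventually (\<lambda>n. \<bar>Z x\<bar> + 1 \<le> K n) sequentially"
        using K by (auto simp: filterlim_at_top)
      ultimately have "eventually (\<lambda>n. indicator {x. \<bar>x\<bar> \<le> K n} (Y n x) = (1::real)) sequentially"
        by eventually_elim auto
      then show "(\<lambda>n. indicator {x. \<bar>x\<bar> \<le> K n} (Y n x)) \<longlonglongrightarrow> (1::real)"
        by (rule tendsto_eventually)
    qed
  qed (auto simp: indicator_def)
  moreover have "(\<integral>x. indicator {x. \<bar>x\<bar> \<le> K n} (Y n x) \<partial>\<Omega>) = measure (\<mu> n) {x. \<bar>x\<bar> \<le> K n}" for n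
    by (subst dY[symmetric], subst integral_distr[symmetric, where N=borel]) auto
  ultimately show ?thesis by (simp add: prob_space)
qed

section \<open>Gaussian estimates for small balls\<close>

lemma std_normal_measure_abs_le:
  assumes "0 \<le> a"
  shows "measure std_normal_distribution {x. \<bar>x\<bar> \<le> a} \<le> a"
proof -
  interpret N: real_distribution std_normal_distribution by (rule real_dist_normal_dist)
  have "emeasure std_normal_distribution {x. \<bar>x\<bar> \<le> a}
      = (\<integral>\<^sup>+x\<in>{-a..a}. ennreal (std_normal_density x) \<partial>lborel)"
    by (subst emeasure_density) (auto intro!: nn_integral_cong simp: abs_le_iff indicator_def)
  also have "\<dots> \<le> (\<integral>\<^sup>+x. ennreal (1/2) * indicator {-a..a} x \<partial>lborel)"
  proof (intro nn_integral_mono)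
    fix x :: real
    \<comment> \<open>The density is at most 1/2 because \<open>sqrt (2 * pi)\<close> is at least 2;
      over the length \<open>2 * a\<close> this gives \<open>a\<close>.\<close>
    have "4 \<le> 2 * pi" using pi_gt3 by simp
    then have "2 \<le> sqrt (2 * pi)" by (intro real_le_rsqrt) simp
    then have "std_normal_density x \<le> (1/2) * 1"
      unfolding std_normal_density_def by (intro mult_mono) (auto simp: field_simps)
    then show "ennreal (std_normal_density x) * indicator {-a..a} x \<le> ennreal (1/2) * indicator {-a..a} x"
      by (intro mult_right_mono ennreal_leI) auto
  qed
  also have "\<dots> = ennreal (1/2) * ennreal (2 * a)"
    using assms by (simp add: nn_integral_cmult)
  also have "\<dots> = ennreal a" using assms by (subst ennreal_mult[symmetric]) auto
  finally show ?thesis using assms by (simp add: N.emeasure_eq_measure)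
qed

text \<open>The standard normal law is, up to scaling, its own characteristic function: averaging the
  characteristic function over it gives a Gaussian test function, which dominates the ball.\<close>

lemma (in real_distribution) small_ball_le_char:
  assumes \<epsilon>: "0 < \<epsilon>"
  shows "measure M {x. \<bar>x\<bar> < \<epsilon>} \<le> 2 * (\<integral>s. cmod (char M (s / \<epsilon>)) \<partial>std_normal_distribution)"
proof -
  interpret N: real_distribution std_normal_distribution by (rule real_dist_normal_dist)
  interpret P: pair_prob_space M std_normal_distribution ..
  define g where "g x = exp (- (x / \<epsilon>)\<^sup>2 / 2)" for x :: real
  have g_char: "of_real (g x) = (\<integral>s. iexp (x / \<epsilon> * s) \<partial>std_normal_distribution)" for x
    using fun_cong[OF char_std_normal_distribution, of "x / \<epsilon>"] by (simp add: char_def g_def)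
  have [measurable]: "g \<in> borel_measurable M" unfolding g_def by measurable
  have intg: "integrable M g" by (intro integrable_const_bound[of _ 1]) (auto simp: g_def)
  have int: "integrable (M \<Otimes>\<^sub>M std_normal_distribution) (\<lambda>(x, s). iexp (x / \<epsilon> * s))"
    by (intro P.integrable_const_bound[of _ 1]) (auto split: prod.splits simp del: of_real_mult)
  \<comment> \<open>On the ball \<open>g\<close> is at least \<open>exp (- (1/2))\<close>, so this
    inequality lets \<open>2 * g\<close> dominate the indicator.\<close>
  have e: "exp (1/2) \<le> (2::real)"
  proof -
    have "(exp (1/2))\<^sup>2 = exp (1::real)" by (simp add: power2_eq_square exp_add[symmetric])
    then have "(exp (1/2::real))\<^sup>2 \<le> 2\<^sup>2" using exp_le by simp
    then show ?thesis by (rule power2_le_imp_le) simp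
  qed
  have "measure M {x. \<bar>x\<bar> < \<epsilon>} = (\<integral>x. indicator {x. \<bar>x\<bar> < \<epsilon>} x \<partial>M)" by simp
  also have "\<dots> \<le> (\<integral>x. 2 * g x \<partial>M)"
  proof (intro integral_mono)
    fix x
    show "indicator {x. \<bar>x\<bar> < \<epsilon>} x \<le> 2 * g x"
    proof (cases "\<bar>x\<bar> < \<epsilon>")
      case True
      then have "\<bar>x / \<epsilon>\<bar> \<le> 1" using \<epsilon> by (simp add: field_simps)
      then have "(x / \<epsilon>)\<^sup>2 \<le> 1" using abs_square_le_1 by blast
      then have "exp (- (1/2)) \<le> g x" unfolding g_def by simp
      moreover have "1 \<le> 2 * exp (- (1/2::real))" using e by (simp add: exp_minus field_simps)
      ultimately show ?thesis using True by simp
    qed (simp add: g_def)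
  qed (auto intro!: intg integrable_real_indicator simp: emeasure_eq_measure)
  also have "\<dots> = 2 * cmod (of_real (\<integral>x. g x \<partial>M))" by (simp add: g_def integral_nonneg)
  also have "of_real (\<integral>x. g x \<partial>M) = (\<integral>x. complex_of_real (g x) \<partial>M)" by simp
  also have "\<dots> = (\<integral>x. (\<integral>s. iexp (x / \<epsilon> * s) \<partial>std_normal_distribution) \<partial>M)"
    by (simp only: g_char)
  also have "\<dots> = (\<integral>s. (\<integral>x. iexp (x / \<epsilon> * s) \<partial>M) \<partial>std_normal_distribution)"
    by (rule P.Fubini_integral[OF int, symmetric])
  also have "\<dots> = (\<integral>s. char M (s / \<epsilon>) \<partial>std_normal_distribution)"
    by (simp add: char_def mult.commute)
  also have "2 * cmod \<dots> \<le> 2 * (\<integral>s. cmod (char M (s / \<epsilon>)) \<partial>std_normal_distribution)"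
    by (intro mult_left_mono integral_norm_bound) auto
  finally show ?thesis .
qed

section \<open>Regular variation of the characteristic function at zero\<close>

text \<open>The power function satisfies the halving relation with equality, so a comparison on the
  window from \<open>\<delta> / 2\<close> to \<open>\<delta>\<close> propagates to all smaller
  scales. The sign of \<open>\<kappa>\<close> is free, so negating both sides yields upper bounds as
  well.\<close>

lemma powr_lower_bound_dyadic:
  fixes g :: "real \<Rightarrow> real"
  assumes base: "\<And>s. \<delta> / 2 < s \<Longrightarrow> s \<le> \<delta> \<Longrightarrow> \<kappa> * s powr p \<le> g s"
    and half: "\<And>s. 0 < s \<Longrightarrow> s \<le> \<delta> \<Longrightarrow> 2 powr - p * g s \<le> g (s / 2)"
    and s: "0 < s" "s \<le> \<delta>"
  shows "\<kappa> * s powr p \<le> g s"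
proof -
  have *: "\<kappa> * s powr p \<le> g s" if "\<delta> / 2 ^ Suc k < s" "s \<le> \<delta>" "0 < s" for k s
    using that
  proof (induction k arbitrary: s)
    case 0
    then show ?case using base by simp
  next
    case (Suc k)
    show ?case
    proof (cases "\<delta> / 2 < s")
      case True
      then show ?thesis using base Suc.prems by simp
    next
      case False
      have "\<kappa> * (2 * s) powr p \<le> g (2 * s)"
        using Suc.prems False by (intro Suc.IH) (auto simp: field_simps)
      then have "2 powr - p * (\<kappa> * (2 * s) powr p) \<le> 2 powr - p * g (2 * s)"
        by (intro mult_left_mono) auto
      also have "\<dots> \<le> g (2 * s / 2)" using Suc.prems False by (intro half) auto
      also have "2 powr - p * (\<kappa> * (2 * s) powr p) = \<kappa> * s powr p"
        using Suc.prems by (simp add: powr_mult powr_minus field_simps)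
      finally show ?thesis by simp
    qed
  qed
  obtain k :: nat where "\<delta> / s < 2 ^ k" using real_arch_pow[of 2 "\<delta> / s"] by auto
  also have "(2::real) ^ k \<le> 2 ^ Suc k" by simp
  finally have "\<delta> / 2 ^ Suc k < s" using s by (simp add: field_simps)
  then show ?thesis using * s by blast
qed

text \<open>The function \<open>f\<close> stands for the modulus of the characteristic function of a step. The
  locale assumptions make \<open>- ln f\<close> regularly varying of index \<open>\<alpha>\<close> at \<open>0\<close> and
  \<open>a\<close> regularly varying of index \<open>1 / \<alpha>\<close>; only power bounds with an arbitrarily small loss in
  the exponent are extracted.\<close>

locale stable_modulus =
  fixes f :: "real \<Rightarrow> real" and a :: "nat \<Rightarrow> real" and c \<alpha> :: real
  assumes f_nonneg: "0 \<le> f t"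
    and f_le_1: "f t \<le> 1"
    and f_0: "f 0 = 1"
    and f_cont: "isCont f 0"
    and f_away: "0 < \<delta> \<Longrightarrow> \<exists>\<rho>>0. \<rho> < 1 \<and> (\<forall>t. \<delta> \<le> \<bar>t\<bar> \<longrightarrow> f t \<le> \<rho>)"
    and a_pos: "0 < a n"
    and c_pos: "0 < c"
    and \<alpha>_pos: "0 < \<alpha>"
    and f_lim: "uniform_limit {0..2} (\<lambda>n u. f (u / a n) ^ n) (\<lambda>u. exp (- c * u powr \<alpha>)) sequentially"
begin

text \<open>In terms of this exponent \<open>f_lim\<close> says that
  \<open>n * \<psi> (u / a n)\<close> tends to \<open>c * u powr \<alpha>\<close>. It carries
  information only where \<open>f\<close> is positive, which \<open>f_near_0\<close> provides near
  the origin.\<close>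

definition \<psi> :: "real \<Rightarrow> real" where
  "\<psi> s = - ln (f s)"

lemma f_near_0: "\<exists>\<delta>>0. \<forall>s. \<bar>s\<bar> \<le> \<delta> \<longrightarrow> 1 / 2 < f s"
proof -
  have "(f \<longlongrightarrow> f 0) (nhds 0)"
    using f_cont unfolding isCont_def tendsto_at_iff_tendsto_nhds .
  then have "eventually (\<lambda>s. 1 / 2 < f s) (nhds 0)"
    by (rule order_tendstoD) (simp add: f_0)
  then obtain d where "0 < d" "\<And>s. dist s 0 < d \<Longrightarrow> 1 / 2 < f s"
    by (auto simp: eventually_nhds_metric)
  then show ?thesis by (intro exI[of _ "d / 2"]) auto
qed

text \<open>Whenever \<open>a n\<close> is below \<open>Z\<close>, the point \<open>1 / a n\<close>
  keeps away from 0 and \<open>f (1 / a n) ^ n\<close> is at most \<open>\<rho> ^ n\<close>, which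
  vanishes. The limit \<open>exp (- c)\<close> is positive, so this happens only finitely
  often.\<close>

lemma a_at_top: "filterlim a at_top sequentially"
  unfolding filterlim_at_top_gt[where c = 0]
proof (intro allI impI)
  fix Z :: real assume Z: "0 < Z"
  obtain \<rho> where \<rho>: "0 < \<rho>" "\<rho> < 1" "\<And>t. 1 / Z \<le> \<bar>t\<bar> \<Longrightarrow> f t \<le> \<rho>"
    using f_away[of "1 / Z"] Z by auto
  have lim: "(\<lambda>n. f (1 / a n) ^ n) \<longlonglongrightarrow> exp (- c * 1 powr \<alpha>)"
    by (rule tendsto_uniform_limitI[OF f_lim]) simp
  have "(\<lambda>n. f (1 / a n) ^ n - \<rho> ^ n) \<longlonglongrightarrow> exp (- c * 1 powr \<alpha>) - 0"
    using \<rho> by (intro tendsto_diff lim LIMSEQ_realpow_zero) auto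
  then have "eventually (\<lambda>n. 0 < f (1 / a n) ^ n - \<rho> ^ n) sequentially"
    by (rule order_tendstoD) simp
  then show "eventually (\<lambda>n. Z \<le> a n) sequentially"
  proof eventually_elim
    case (elim n)
    show ?case
    proof (rule ccontr)
      assume "\<not> Z \<le> a n"
      then have "1 / Z \<le> \<bar>1 / a n\<bar>" using a_pos[of n] Z by (simp add: field_simps)
      from power_mono[OF \<rho>(3)[OF this] f_nonneg, of n] elim show False by simp
    qed
  qed
qed

lemma psi_uniform:
  assumes e: "0 < e"
  shows "eventually (\<lambda>n. \<forall>u\<in>{0..2}. \<bar>real n * \<psi> (u / a n) - c * u powr \<alpha>\<bar> < e) sequentially"
proof -
  define m where "m = exp (- c * 2 powr \<alpha>)"
  have m: "0 < m" by (simp add: m_def)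
  \<comment> \<open>The limit is at least \<open>m\<close> on the whole interval. The first
    tolerance keeps \<open>x\<close> above \<open>m / 2\<close>; the second makes
    \<open>\<bar>x - y\<bar> / (m / 2)\<close>, which bounds the difference of the logarithms,
    smaller than \<open>e\<close>.\<close>
  have "eventually (\<lambda>n. \<forall>u\<in>{0..2}. dist (f (u / a n) ^ n) (exp (- c * u powr \<alpha>)) < min (m / 2) (e * m / 2)) sequentially"
    using m e by (intro uniform_limitD[OF f_lim]) auto
  then show ?thesis
    using eventually_ge_at_top[of 1]
  proof eventually_elim
    case (elim n)
    show ?case
    proof
      fix u :: real assume u: "u \<in> {0..2}"
      define x where "x = f (u / a n) ^ n"
      define y where "y = exp (- c * u powr \<alpha>)"
      have d: "\<bar>x - y\<bar> < m / 2" "\<bar>x - y\<bar> < e * (m / 2)"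
        using elim(1) u by (auto simp: x_def y_def dist_real_def)
      have y: "m \<le> y"
        using u c_pos \<alpha>_pos by (auto simp: m_def y_def intro!: powr_mono2)
      have x: "m / 2 < x" using d y by linarith
      have "0 < f (u / a n)"
      proof (rule ccontr)
        assume "\<not> 0 < f (u / a n)"
        then have "f (u / a n) = 0" using f_nonneg[of "u / a n"] by simp
        then show False using x m elim(2) by (simp add: x_def power_0_left)
      qed
      then have "ln x = real n * ln (f (u / a n))" by (simp add: x_def ln_realpow)
      then have eq: "real n * \<psi> (u / a n) - c * u powr \<alpha> = ln y - ln x"
        by (simp add: \<psi>_def y_def)
      have "ln y - ln x \<le> (y - x) / x" using x y m by (intro ln_diff_le) auto
      also have "\<dots> \<le> \<bar>x - y\<bar> / (m / 2)" using x m by (intro frac_le) auto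
      finally have 1: "ln y - ln x \<le> \<bar>x - y\<bar> / (m / 2)" .
      have "ln x - ln y \<le> (x - y) / y" using x y m by (intro ln_diff_le) auto
      also have "\<dots> \<le> \<bar>x - y\<bar> / (m / 2)" using y m by (intro frac_le) auto
      finally have "\<bar>ln y - ln x\<bar> \<le> \<bar>x - y\<bar> / (m / 2)" using 1 by simp
      also have "\<dots> < e" using d(2) m by (simp add: pos_divide_less_eq)
      finally show "\<bar>real n * \<psi> (u / a n) - c * u powr \<alpha>\<bar> < e" by (simp only: eq)
    qed
  qed
qed

text \<open>If \<open>a\<close> more than doubled in one step,
  \<open>n * \<psi> (1 / a (Suc n))\<close> would be near \<open>c * u powr \<alpha>\<close> with
  \<open>u < 1 / 2\<close>, while \<open>Suc n\<close> copies of the same value are near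
  \<open>c\<close>. The one extra copy is of order \<open>1 / n\<close> and cannot make up the
  difference.\<close>

lemma a_Suc_le: "eventually (\<lambda>n. a (Suc n) \<le> 2 * a n) sequentially"
proof -
  \<comment> \<open>The gap between \<open>c\<close> and \<open>c * 2 powr - \<alpha>\<close> is
    \<open>4 * d\<close>. Each of the two approximations costs \<open>d\<close>, and the remaining
    \<open>2 * d\<close> exceeds the extra copy, which is below \<open>d\<close>.\<close>
  define d where "d = c * (1 - 2 powr - \<alpha>) / 4"
  have lt: "2 powr - \<alpha> < (1::real)" using \<alpha>_pos by (simp add: powr_minus powr_less_one inverse_less_1_iff)
  then have d: "0 < d" using c_pos by (simp add: d_def)
  have "eventually (\<lambda>n::nat. c / real n < d) sequentially"
    using d by real_asymp
  with psi_uniform[OF d] psi_uniform[OF d, THEN eventually_sequentially_Suc[THEN iffD2]]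
  show ?thesis
    using eventually_ge_at_top[of 1]
  proof eventually_elim
    case (elim n)
    show ?case
    proof (rule ccontr)
      assume neg: "\<not> ?case"
      define u where "u = a n / a (Suc n)"
      have u: "0 < u" "u < 1 / 2" using neg a_pos[of n] a_pos[of "Suc n"] by (auto simp: u_def field_simps)
      have "u / a n = 1 / a (Suc n)" using a_pos[of n] by (simp add: u_def)
      with elim(1) u have "real n * \<psi> (1 / a (Suc n)) < c * u powr \<alpha> + d"
        using bspec[OF elim(1), of u] by (simp add: abs_diff_less_iff)
      also have "u powr \<alpha> \<le> (1 / 2) powr \<alpha>" using u \<alpha>_pos by (intro powr_mono2) auto
      also have "(1 / 2) powr \<alpha> = 2 powr - \<alpha>" by (simp add: powr_divide powr_minus field_simps)
      finally have 1: "real n * \<psi> (1 / a (Suc n)) < c - 3 * d"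
        using c_pos by (simp add: d_def field_simps)
      have "c - d < real (Suc n) * \<psi> (1 / a (Suc n))"
        using bspec[OF elim(2), of 1] by (simp add: abs_diff_less_iff)
      with 1 have "2 * d < \<psi> (1 / a (Suc n))" by (simp add: algebra_simps)
      moreover have "\<psi> (1 / a (Suc n)) < c / real n"
        using 1 d elim(4) by (simp add: field_simps)
      ultimately show False using elim(3) d by simp
    qed
  qed
qed

text \<open>Passes from the sequence \<open>1 / a n\<close> to all small \<open>s\<close>. The first
  \<open>n\<close> with \<open>1 / s \<le> a n\<close> satisfies \<open>a n < 2 / s\<close> because
  \<open>a\<close> at most doubles, so \<open>u = s * a n\<close> lies between 1 and 2. One pair
  \<open>n\<close>, \<open>u\<close> serves both \<open>s\<close> and \<open>s / 2\<close>, so that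
  the two values can be compared.\<close>

lemma psi_scale:
  assumes e: "0 < e"
  shows "\<exists>\<delta>>0. \<forall>s. 0 < s \<longrightarrow> s \<le> \<delta> \<longrightarrow> (\<exists>n u. 1 \<le> n \<and> 1 \<le> u \<and>
    \<bar>real n * \<psi> s - c * u powr \<alpha>\<bar> < e \<and> \<bar>real n * \<psi> (s / 2) - c * (u / 2) powr \<alpha>\<bar> < e)"
proof -
  obtain N where N: "\<And>n. N \<le> n \<Longrightarrow> a (Suc n) \<le> 2 * a n"
    "\<And>n u. N \<le> n \<Longrightarrow> u \<in> {0..2} \<Longrightarrow> \<bar>real n * \<psi> (u / a n) - c * u powr \<alpha>\<bar> < e"
    using eventually_conj[OF a_Suc_le psi_uniform[OF e]] unfolding eventually_sequentially by blast
  \<comment> \<open>\<open>B\<close> bounds \<open>a\<close> up to \<open>N\<close>, so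
    \<open>s \<le> 1 / (2 * B)\<close> pushes the first crossing beyond \<open>N\<close>, and its
    predecessor is at least \<open>N\<close>.\<close>
  define B where "B = Max (a ` {..N})"
  have B: "a n \<le> B" if "n \<le> N" for n
    using that by (auto simp: B_def intro!: Max_ge)
  have B0: "0 < B" using a_pos[of N] B[of N] by simp
  show ?thesis
  proof (intro exI[of _ "1 / (2 * B)"] conjI allI impI)
    fix s :: real assume s: "0 < s" "s \<le> 1 / (2 * B)"
    obtain n0 where n0: "1 / s \<le> a n0"
      using filterlim_at_top[THEN iffD1, OF a_at_top, rule_format, of "1 / s"]
      by (auto simp: eventually_sequentially)
    define n where "n = (LEAST n. 1 / s \<le> a n)"
    have n1: "1 / s \<le> a n" unfolding n_def using n0 by (rule LeastI)
    have "B < 1 / s" using s B0 by (simp add: field_simps)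
    then have "N < n" using B[of n] n1 by (meson leI le_less_trans not_less)
    then obtain k where k: "n = Suc k" "N \<le> k" by (cases n) auto
    have "a k < 1 / s" using not_less_Least[of k "\<lambda>n. 1 / s \<le> a n"] k n_def by auto
    then have n2: "a n < 2 / s" using N(1)[OF k(2)] k(1) by simp
    define u where "u = s * a n"
    have u: "1 \<le> u" "u \<le> 2" using n1 n2 s by (auto simp: u_def field_simps)
    have "u / a n = s" "(u / 2) / a n = s / 2" using a_pos[of n] by (auto simp: u_def)
    then show "\<exists>n u. 1 \<le> n \<and> 1 \<le> u \<and>
      \<bar>real n * \<psi> s - c * u powr \<alpha>\<bar> < e \<and> \<bar>real n * \<psi> (s / 2) - c * (u / 2) powr \<alpha>\<bar> < e"
      using N(2)[of n u] N(2)[of n "u / 2"] u \<open>N < n\<close> by (intro exI[of _ n] exI[of _ u]) (auto simp: mult.commute)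
  qed (use B0 in auto)
qed

text \<open>Halving the argument multiplies \<open>c * u powr \<alpha>\<close> by
  \<open>2 powr - \<alpha>\<close>, which exceeds \<open>2 powr - p\<close>; since
  \<open>u powr \<alpha>\<close> is at least 1, the gap absorbs the approximation errors.\<close>

lemma psi_half_ge:
  assumes p: "\<alpha> < p"
  shows "\<exists>\<delta>>0. \<forall>s. 0 < s \<longrightarrow> s \<le> \<delta> \<longrightarrow> 2 powr - p * \<psi> s \<le> \<psi> (s / 2)"
proof -
  \<comment> \<open>The gap at \<open>u = 1\<close> is \<open>2 * e\<close>, and the errors add up
    to \<open>(2 powr - p + 1) * e\<close>, which is no larger.\<close>
  define e where "e = c * (2 powr - \<alpha> - 2 powr - p) / 2"
  have lt: "2 powr - p < 2 powr (- \<alpha> :: real)" using p by simp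
  have p1: "2 powr - p \<le> (1::real)" using p \<alpha>_pos by (simp add: powr_minus ge_one_powr_ge_zero inverse_le_1_iff)
  have e: "0 < e" using lt c_pos by (simp add: e_def)
  obtain \<delta> where \<delta>: "\<delta> > 0" "\<And>s. 0 < s \<Longrightarrow> s \<le> \<delta> \<Longrightarrow> (\<exists>n u. 1 \<le> n \<and> 1 \<le> u \<and>
    \<bar>real n * \<psi> s - c * u powr \<alpha>\<bar> < e \<and> \<bar>real n * \<psi> (s / 2) - c * (u / 2) powr \<alpha>\<bar> < e)"
    using psi_scale[OF e] by blast
  show ?thesis
  proof (intro exI[of _ \<delta>] conjI allI impI \<delta>(1))
    fix s :: real assume "0 < s" "s \<le> \<delta>"
    from \<delta>(2)[OF this] obtain n u where nu: "1 \<le> n" "1 \<le> u"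
      "\<bar>real n * \<psi> s - c * u powr \<alpha>\<bar> < e" "\<bar>real n * \<psi> (s / 2) - c * (u / 2) powr \<alpha>\<bar> < e"
      by blast
    define U where "U = u powr \<alpha>"
    have U: "1 \<le> U" using nu(2) \<alpha>_pos by (simp add: U_def ge_one_powr_ge_zero)
    have half: "(u / 2) powr \<alpha> = U * 2 powr - \<alpha>" using nu(2) by (simp add: U_def powr_divide powr_minus field_simps)
    have "2 powr - p * (real n * \<psi> s) \<le> 2 powr - p * (c * U + e)"
      using nu(3) by (intro mult_left_mono) (auto simp: U_def abs_diff_less_iff)
    also have "\<dots> \<le> 2 powr - p * (c * U) + 1 * e"
      using p1 e by (simp add: distrib_left)
    also have "\<dots> \<le> c * (U * 2 powr - \<alpha>) - e"
    proof -
      have A: "2 * e = c * (2 powr - \<alpha> - 2 powr - p)" by (simp add: e_def)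
      have "2 * e \<le> 2 * e * U" using e U by simp
      then have "2 * e \<le> c * (2 powr - \<alpha> - 2 powr - p) * U" by (subst A[symmetric])
      then show ?thesis by (simp add: algebra_simps)
    qed
    also have "\<dots> \<le> real n * \<psi> (s / 2)" using nu(4) half by (simp add: abs_diff_less_iff)
    finally have "real n * (2 powr - p * \<psi> s) \<le> real n * \<psi> (s / 2)" by (simp add: mult_ac)
    then show "2 powr - p * \<psi> s \<le> \<psi> (s / 2)" using nu(1) by simp
  qed
qed

text \<open>The comparison of \<open>psi_half_ge\<close> with the gap reversed: now
  \<open>2 powr - p\<close> is the larger factor.\<close>

lemma psi_half_le:
  assumes p: "0 < p" "p < \<alpha>"
  shows "\<exists>\<delta>>0. \<forall>s. 0 < s \<longrightarrow> s \<le> \<delta> \<longrightarrow> \<psi> (s / 2) \<le> 2 powr - p * \<psi> s"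
proof -
  define e where "e = c * (2 powr - p - 2 powr - \<alpha>) / 2"
  have lt: "2 powr - \<alpha> < 2 powr (- p :: real)" using p by simp
  have p1: "2 powr - p \<le> (1::real)" using p by (simp add: powr_minus ge_one_powr_ge_zero inverse_le_1_iff)
  have e: "0 < e" using lt c_pos by (simp add: e_def)
  obtain \<delta> where \<delta>: "\<delta> > 0" "\<And>s. 0 < s \<Longrightarrow> s \<le> \<delta> \<Longrightarrow> (\<exists>n u. 1 \<le> n \<and> 1 \<le> u \<and>
    \<bar>real n * \<psi> s - c * u powr \<alpha>\<bar> < e \<and> \<bar>real n * \<psi> (s / 2) - c * (u / 2) powr \<alpha>\<bar> < e)"
    using psi_scale[OF e] by blast
  show ?thesis
  proof (intro exI[of _ \<delta>] conjI allI impI \<delta>(1))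
    fix s :: real assume "0 < s" "s \<le> \<delta>"
    from \<delta>(2)[OF this] obtain n u where nu: "1 \<le> n" "1 \<le> u"
      "\<bar>real n * \<psi> s - c * u powr \<alpha>\<bar> < e" "\<bar>real n * \<psi> (s / 2) - c * (u / 2) powr \<alpha>\<bar> < e"
      by blast
    define U where "U = u powr \<alpha>"
    have U: "1 \<le> U" using nu(2) \<alpha>_pos by (simp add: U_def ge_one_powr_ge_zero)
    have half: "(u / 2) powr \<alpha> = U * 2 powr - \<alpha>" using nu(2) by (simp add: U_def powr_divide powr_minus field_simps)
    have "real n * \<psi> (s / 2) \<le> c * (U * 2 powr - \<alpha>) + e" using nu(4) half by (simp add: abs_diff_less_iff)
    also have "\<dots> \<le> 2 powr - p * (c * U) - 1 * e"
    proof -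
      have A: "2 * e = c * (2 powr - p - 2 powr - \<alpha>)" by (simp add: e_def)
      have "2 * e \<le> 2 * e * U" using e U by simp
      then have "2 * e \<le> c * (2 powr - p - 2 powr - \<alpha>) * U" by (subst A[symmetric])
      then show ?thesis by (simp add: algebra_simps)
    qed
    also have "\<dots> \<le> 2 powr - p * (c * U - e)"
      using p1 e by (simp add: right_diff_distrib)
    also have "\<dots> \<le> 2 powr - p * (real n * \<psi> s)"
      using nu(3) by (intro mult_left_mono) (auto simp: U_def abs_diff_less_iff)
    finally have "real n * \<psi> (s / 2) \<le> real n * (2 powr - p * \<psi> s)" by (simp add: mult_ac)
    then show "\<psi> (s / 2) \<le> 2 powr - p * \<psi> s" using nu(1) by simp
  qed
qed

text \<open>On the window from \<open>\<delta> / 2\<close> to \<open>\<delta>\<close> the bound away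
  from 0 gives \<open>- ln \<rho> \<le> \<psi> x\<close>; \<open>psi_half_ge\<close> carries it down
  to 0 at the cost of an exponent above \<alpha>.\<close>

lemma f_le_exp_powr:
  assumes p: "\<alpha> < p"
  shows "\<exists>\<delta>>0. \<exists>\<kappa>>0. \<forall>s. 0 < s \<longrightarrow> s \<le> \<delta> \<longrightarrow> f s \<le> exp (- \<kappa> * s powr p)"
proof -
  obtain \<delta>1 where \<delta>1: "0 < \<delta>1" "\<And>s. \<bar>s\<bar> \<le> \<delta>1 \<Longrightarrow> 1 / 2 < f s" using f_near_0 by blast
  obtain \<delta>2 where \<delta>2: "0 < \<delta>2" "\<And>s. 0 < s \<Longrightarrow> s \<le> \<delta>2 \<Longrightarrow> 2 powr - p * \<psi> s \<le> \<psi> (s / 2)"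
    using psi_half_ge[OF p] by blast
  define \<delta> where "\<delta> = min \<delta>1 \<delta>2"
  have \<delta>: "0 < \<delta>" using \<delta>1 \<delta>2 by (simp add: \<delta>_def)
  obtain \<rho> where \<rho>: "0 < \<rho>" "\<rho> < 1" "\<And>t. \<delta> / 2 \<le> \<bar>t\<bar> \<Longrightarrow> f t \<le> \<rho>"
    using f_away[of "\<delta> / 2"] \<delta> by auto
  \<comment> \<open>Normalised at the right end of the window, where the power is largest.\<close>
  define \<kappa> where "\<kappa> = - ln \<rho> * \<delta> powr - p"
  have \<kappa>: "0 < \<kappa>" using \<rho> \<delta> by (simp add: \<kappa>_def mult_neg_pos)
  show ?thesis
  proof (intro exI conjI allI impI)
    fix s assume s: "0 < s" "s \<le> \<delta>"
    have fs: "0 < f s" using \<delta>1(2)[of s] s by (simp add: \<delta>_def)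
    have "\<kappa> * s powr p \<le> \<psi> s"
    proof (rule powr_lower_bound_dyadic[where \<delta> = \<delta>])
      fix x assume x: "\<delta> / 2 < x" "x \<le> \<delta>"
      have x0: "0 < x" using x \<delta> by linarith
      have "0 < f x" using \<delta>1(2)[of x] x x0 by (simp add: \<delta>_def)
      moreover have "f x \<le> \<rho>" using \<rho>(3)[of x] x x0 by simp
      ultimately have "- ln \<rho> \<le> \<psi> x" by (simp add: \<psi>_def)
      moreover have "\<kappa> * x powr p \<le> \<kappa> * \<delta> powr p"
        using x x0 \<kappa> p \<alpha>_pos by (intro mult_left_mono powr_mono2) auto
      moreover have "\<kappa> * \<delta> powr p = - ln \<rho>" using \<delta> by (simp add: \<kappa>_def powr_minus)
      ultimately show "\<kappa> * x powr p \<le> \<psi> x" by simp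
    qed (use \<delta>2 s in \<open>auto simp: \<delta>_def\<close>)
    then have "ln (f s) \<le> - \<kappa> * s powr p" by (simp add: \<psi>_def)
    then show "f s \<le> exp (- \<kappa> * s powr p)" using fs by (metis exp_le_cancel_iff exp_ln)
  qed (rule \<delta> \<kappa>)+
qed

lemma psi_le_powr:
  assumes p: "0 < p" "p < \<alpha>"
  shows "\<exists>\<delta>>0. \<exists>\<kappa>>0. \<forall>s. 0 < s \<longrightarrow> s \<le> \<delta> \<longrightarrow> \<psi> s \<le> \<kappa> * s powr p"
proof -
  obtain \<delta>1 where \<delta>1: "0 < \<delta>1" "\<And>s. \<bar>s\<bar> \<le> \<delta>1 \<Longrightarrow> 1 / 2 < f s" using f_near_0 by blast
  obtain \<delta>2 where \<delta>2: "0 < \<delta>2" "\<And>s. 0 < s \<Longrightarrow> s \<le> \<delta>2 \<Longrightarrow> \<psi> (s / 2) \<le> 2 powr - p * \<psi> s"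
    using psi_half_le[OF p] by blast
  define \<delta> where "\<delta> = min \<delta>1 \<delta>2"
  have \<delta>: "0 < \<delta>" using \<delta>1 \<delta>2 by (simp add: \<delta>_def)
  \<comment> \<open>On the window the exponent is at most \<open>ln 2\<close>; the constant is
    normalised at the left end, where the power is smallest.\<close>
  define \<kappa> where "\<kappa> = ln 2 * (\<delta> / 2) powr - p"
  have \<kappa>: "0 < \<kappa>" using \<delta> by (simp add: \<kappa>_def)
  show ?thesis
  proof (intro exI conjI allI impI)
    fix s assume s: "0 < s" "s \<le> \<delta>"
    \<comment> \<open>An upper bound on \<open>\<psi>\<close> is a lower bound on
      \<open>- \<psi>\<close> with a negative constant.\<close>
    have "- \<kappa> * s powr p \<le> - \<psi> s"
    proof (rule powr_lower_bound_dyadic[where \<delta> = \<delta>])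
      fix x assume x: "\<delta> / 2 < x" "x \<le> \<delta>"
      have x0: "0 < x" using x \<delta> by linarith
      have "1 / 2 < f x" using \<delta>1(2)[of x] x x0 by (simp add: \<delta>_def)
      then have "ln (1 / 2) \<le> ln (f x)" by simp
      then have "\<psi> x \<le> ln 2" by (simp add: \<psi>_def ln_div)
      moreover have "\<kappa> * (\<delta> / 2) powr p \<le> \<kappa> * x powr p"
        using x \<delta> \<kappa> p by (intro mult_left_mono powr_mono2) auto
      moreover have "\<kappa> * (\<delta> / 2) powr p = ln 2" using \<delta> by (simp add: \<kappa>_def powr_minus)
      ultimately show "- \<kappa> * x powr p \<le> - \<psi> x" by simp
    qed (use \<delta>2 s in \<open>auto simp: \<delta>_def\<close>)
    then show "\<psi> s \<le> \<kappa> * s powr p" by simp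
  qed (rule \<delta> \<kappa>)+
qed

text \<open>At \<open>u = 1\<close> the value \<open>n * \<psi> (1 / a n)\<close> stays above
  \<open>c / 2\<close>, while \<open>psi_le_powr\<close> bounds it by
  \<open>n * \<kappa> / a n powr q\<close> with \<open>1 / p < q < \<alpha>\<close>. Hence
  \<open>a n powr q\<close> is of order \<open>n\<close>, which is eventually below
  \<open>n powr (p * q)\<close>.\<close>

lemma a_le_powr:
  assumes p: "1 / \<alpha> < p"
  shows "eventually (\<lambda>n. a n \<le> real n powr p) sequentially"
proof -
  have p0: "0 < p" using p \<alpha>_pos by (meson less_trans zero_less_divide_1_iff)
  have "1 / p < \<alpha>" using p \<alpha>_pos p0 by (simp add: field_simps)
  then obtain q where q: "1 / p < q" "q < \<alpha>" using dense by blast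
  have q0: "0 < q" using q p0 by (meson less_trans zero_less_divide_1_iff)
  have pq: "1 < p * q" using q p0 by (simp add: field_simps)
  obtain \<delta> \<kappa> where \<delta>: "0 < \<delta>" "0 < \<kappa>" "\<And>s. 0 < s \<Longrightarrow> s \<le> \<delta> \<Longrightarrow> \<psi> s \<le> \<kappa> * s powr q"
    using psi_le_powr[OF q0 q(2)] by blast
  have "eventually (\<lambda>n. 1 / \<delta> \<le> a n) sequentially"
    using a_at_top by (simp add: filterlim_at_top)
  moreover have "eventually (\<lambda>n::nat. (2 * \<kappa> / c) * real n \<le> real n powr (p * q)) sequentially"
  proof -
    have "0 < p * q - 1" using pq by simp
    then have "eventually (\<lambda>n::nat. 2 * \<kappa> / c \<le> real n powr (p * q - 1)) sequentially"
      by real_asymp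
    then show ?thesis using eventually_gt_at_top[of 0]
    proof eventually_elim
      case (elim n)
      then have "(2 * \<kappa> / c) * real n \<le> real n powr (p * q - 1) * real n powr 1"
        by (intro mult_mono) auto
      also have "\<dots> = real n powr (p * q)" using elim by (simp only: powr_add[symmetric]) simp
      finally show ?case .
    qed
  qed
  moreover have "eventually (\<lambda>n. \<forall>u\<in>{0..2}. \<bar>real n * \<psi> (u / a n) - c * u powr \<alpha>\<bar> < c / 2) sequentially"
    using c_pos by (intro psi_uniform) simp
  ultimately show ?thesis
  proof eventually_elim
    case (elim n)
    have "c / 2 < real n * \<psi> (1 / a n)" using bspec[OF elim(3), of 1] by (simp add: abs_if split: if_splits)
    also have "\<psi> (1 / a n) \<le> \<kappa> * (1 / a n) powr q"
      using elim(1) a_pos[of n] \<delta>(1) by (intro \<delta>(3)) (auto simp: field_simps)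
    finally have "c / 2 < real n * (\<kappa> / a n powr q)"
      using a_pos[of n] by (simp add: powr_divide mult_left_mono)
    then have "a n powr q < (2 * \<kappa> / c) * real n"
      using a_pos[of n] c_pos by (simp add: field_simps)
    also have "\<dots> \<le> (real n powr p) powr q" using elim(2) by (simp add: powr_powr)
    finally show ?case
      by (meson less_eq_real_def not_less powr_ge_zero powr_mono2 q0)
  qed
qed

end

section \<open>Random walks with i.i.d. steps\<close>

lemma (in real_distribution) cmod_char_minus: "cmod (char M (- t)) = cmod (char M t)"
proof -
  have "char M (- t) = (\<integral>x. cnj (iexp (t * x)) \<partial>M)"
    by (simp add: char_def exp_cnj)
  also have "\<dots> = cnj (char M t)" unfolding char_def by (rule Bochner_Integration.integral_cnj)
  finally show ?thesis by simp
qed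

locale iid_walk = prob_space M for M :: "'a measure" +
  fixes X :: "nat \<Rightarrow> 'a \<Rightarrow> real" and S :: "nat \<Rightarrow> 'a \<Rightarrow> real"
  assumes X_measurable [measurable]: "\<And>i. X i \<in> borel_measurable M"
    and X_indep: "indep_vars (\<lambda>_. borel) X UNIV"
    and X_ident: "\<And>i. distr M borel (X i) = distr M borel (X 0)"
    and S_eq: "\<And>n. S n = (\<lambda>\<omega>. \<Sum>i<n. X i \<omega>)"
begin

abbreviation \<nu> :: "real measure" where "\<nu> \<equiv> distr M borel (X 0)"

lemma S_measurable [measurable]: "S n \<in> borel_measurable M"
  unfolding S_eq by measurable

lemma real_distribution_step: "real_distribution \<nu>"
  by (rule real_distribution_distr) simp

lemma char_S_scaled: "char (distr M borel (\<lambda>\<omega>. S n \<omega> / a)) t = char \<nu> (t / a) ^ n"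
proof -
  have "char (distr M borel (\<lambda>\<omega>. S n \<omega> / a)) t = char (distr M borel (S n)) (t / a)"
    by (simp add: char_def integral_distr)
  also have "\<dots> = (\<Prod>i<n. char (distr M borel (X i)) (t / a))"
    unfolding S_eq by (rule char_distr_sum[OF indep_vars_subset[OF X_indep]]) simp
  also have "\<dots> = char \<nu> (t / a) ^ n" by (subst X_ident) simp
  finally show ?thesis .
qed

lemma small_ball_S_le:
  assumes "0 < \<epsilon>"
  shows "prob {\<omega>\<in>space M. \<bar>S n \<omega>\<bar> < \<epsilon>} \<le> 2 * (\<integral>s. cmod (char \<nu> (s / \<epsilon>)) ^ n \<partial>std_normal_distribution)"
proof -
  interpret D: real_distribution "distr M borel (S n)" by (rule real_distribution_distr) simp
  have "prob {\<omega>\<in>space M. \<bar>S n \<omega>\<bar> < \<epsilon>} = measure (distr M borel (S n)) {x. \<bar>x\<bar> < \<epsilon>}"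
    by (subst measure_distr) (auto intro!: arg_cong[where f = prob])
  also have "\<dots> \<le> 2 * (\<integral>s. cmod (char (distr M borel (S n)) (s / \<epsilon>)) \<partial>std_normal_distribution)"
    by (rule D.small_ball_le_char[OF assms])
  finally show ?thesis
    using char_S_scaled[of n 1] by (simp add: norm_power)
qed

text \<open>The right-hand side is free of \<open>k\<close>, so the law of a block of steps does not
  depend on its starting time. The product criterion for independence needs the index set to be
  nonempty.\<close>

lemma distr_shifted_steps:
  assumes "1 \<le> n"
  shows "distr M (Pi\<^sub>M {..<n} (\<lambda>_. borel)) (\<lambda>\<omega>. \<lambda>i\<in>{..<n}. X (k + i) \<omega>) = Pi\<^sub>M {..<n} (\<lambda>_. \<nu>)"
proof -
  \<comment> \<open>Grouping the steps into singleton blocks amounts to reindexing by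
    \<open>k + j\<close>.\<close>
  have "indep_vars (\<lambda>j. Pi\<^sub>M {k + j} (\<lambda>_. borel)) (\<lambda>j \<omega>. restrict (\<lambda>i. X i \<omega>) {k + j}) {..<n}"
    by (rule indep_vars_restrict[OF X_indep]) (auto simp: disjoint_family_on_def)
  then have "indep_vars (\<lambda>_. borel) (\<lambda>j \<omega>. (\<lambda>x. x (k + j)) (restrict (\<lambda>i. X i \<omega>) {k + j})) {..<n}"
    by (rule indep_vars_compose2) (auto intro!: measurable_component_singleton)
  then have "indep_vars (\<lambda>_. borel) (\<lambda>j. X (k + j)) {..<n}" by simp
  then have "distr M (Pi\<^sub>M {..<n} (\<lambda>_. borel)) (\<lambda>\<omega>. \<lambda>i\<in>{..<n}. X (k + i) \<omega>)
    = Pi\<^sub>M {..<n} (\<lambda>i. distr M borel (X (k + i)))"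
    using assms by (subst (asm) indep_vars_iff_distr_eq_PiM) (auto simp: lessThan_empty_iff bot_nat_def)
  also have "\<dots> = Pi\<^sub>M {..<n} (\<lambda>_. \<nu>)" by (intro PiM_cong refl X_ident)
  finally show ?thesis .
qed

text \<open>Markov property at time \<open>k\<close>: \<open>S k\<close> depends on the steps before
  \<open>k\<close>, the avoidance event on the next \<open>n\<close> steps, and that block has the
  same law as the first \<open>n\<close> steps.\<close>

lemma prob_avoid_shifted:
  assumes n: "1 \<le> n" and B: "B \<in> sets borel"
  shows "prob {\<omega>\<in>space M. S k \<omega> \<in> B \<and> (\<forall>j\<in>{1..n}. \<epsilon> \<le> \<bar>S (k + j) \<omega> - S k \<omega>\<bar>)}
    = prob {\<omega>\<in>space M. S k \<omega> \<in> B} * prob {\<omega>\<in>space M. \<forall>j\<in>{1..n}. \<epsilon> \<le> \<bar>S j \<omega>\<bar>}"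
proof -
  let ?P = "Pi\<^sub>M {..<n} (\<lambda>_. borel :: real measure)"
  define W where "W k \<omega> = (\<lambda>i\<in>{..<n}. X (k + i) \<omega>)" for k \<omega>
  define E where "E = {x\<in>space ?P. \<forall>j\<in>{1..n}. \<epsilon> \<le> \<bar>\<Sum>i<j. x i\<bar>}"
  have [measurable]: "(\<lambda>x. \<Sum>i<j. x i) \<in> borel_measurable ?P" if "j \<in> {1..n}" for j
    using that by (intro borel_measurable_sum measurable_component_singleton) auto
  have E: "E \<in> sets ?P" unfolding E_def by measurable
  have Wm [measurable]: "W k \<in> measurable M ?P" for k
    unfolding W_def by (intro measurable_restrict) simp
  have shift: "S (k + j) \<omega> - S k \<omega> = (\<Sum>i<j. X (k + i) \<omega>)" for j k \<omega>
    unfolding S_eq by (induction j) auto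
  have W_E: "W k -` E \<inter> space M = {\<omega>\<in>space M. \<forall>j\<in>{1..n}. \<epsilon> \<le> \<bar>S (k + j) \<omega> - S k \<omega>\<bar>}" for k
  proof -
    have "(\<Sum>i<j. W k \<omega> i) = S (k + j) \<omega> - S k \<omega>" if "j \<in> {1..n}" for j \<omega>
      unfolding shift using that by (intro sum.cong) (auto simp: W_def)
    then show ?thesis
      using measurable_space[OF Wm] by (auto simp: E_def)
  qed
  have "prob (W k -` E \<inter> space M) = measure (Pi\<^sub>M {..<n} (\<lambda>_. \<nu>)) E" for k
    using measure_distr[OF Wm E, of k] distr_shifted_steps[OF n, of k] by (simp add: W_def[abs_def])
  then have law: "prob (W k -` E \<inter> space M) = prob (W 0 -` E \<inter> space M)" by simp
  let ?Q = "Pi\<^sub>M {..<k} (\<lambda>_. borel :: real measure)"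
  define V where "V \<omega> = restrict (\<lambda>i. X i \<omega>) {..<k}" for \<omega>
  define D where "D = {x\<in>space ?Q. (\<Sum>i<k. x i) \<in> B}"
  have "(\<lambda>x. \<Sum>i<k. x i) \<in> borel_measurable ?Q"
    by (intro borel_measurable_sum measurable_component_singleton) auto
  then have D: "D \<in> sets ?Q" unfolding D_def using B by measurable
  have Vm: "V \<in> measurable M ?Q" unfolding V_def by (intro measurable_restrict) simp
  have V_D: "V -` D \<inter> space M = {\<omega>\<in>space M. S k \<omega> \<in> B}"
    using measurable_space[OF Vm] by (auto simp: D_def V_def S_eq)
  \<comment> \<open>Disjoint blocks of steps are independent; relabelling the later one to start at
    0 makes it \<open>W k\<close>.\<close>
  have "indep_var (Pi\<^sub>M {..<k} (\<lambda>_. borel)) (\<lambda>\<omega>. restrict (\<lambda>i. X i \<omega>) {..<k})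
      (Pi\<^sub>M {k..<k + n} (\<lambda>_. borel)) (\<lambda>\<omega>. restrict (\<lambda>i. X i \<omega>) {k..<k + n})"
    by (rule indep_var_restrict[OF X_indep]) auto
  then have "indep_var ?Q (id \<circ> V) ?P ((\<lambda>x. \<lambda>i\<in>{..<n}. x (k + i)) \<circ> (\<lambda>\<omega>. restrict (\<lambda>i. X i \<omega>) {k..<k + n}))"
    unfolding V_def
    by (rule indep_var_compose)
       (auto intro!: measurable_component_singleton measurable_restrict)
  moreover have "(\<lambda>x. \<lambda>i\<in>{..<n}. x (k + i)) \<circ> (\<lambda>\<omega>. restrict (\<lambda>i. X i \<omega>) {k..<k + n}) = W k"
    by (auto simp: W_def fun_eq_iff)
  ultimately have "indep_var ?Q V ?P (W k)" by simp
  from indep_varD[OF this D E]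
  have "prob ((\<lambda>\<omega>. (V \<omega>, W k \<omega>)) -` (D \<times> E) \<inter> space M)
      = prob (V -` D \<inter> space M) * prob (W k -` E \<inter> space M)" .
  also have "prob (W k -` E \<inter> space M) = prob {\<omega>\<in>space M. \<forall>j\<in>{1..n}. \<epsilon> \<le> \<bar>S j \<omega>\<bar>}"
    by (subst law, subst W_E) (simp add: S_eq)
  also have "(\<lambda>\<omega>. (V \<omega>, W k \<omega>)) -` (D \<times> E) \<inter> space M
      = {\<omega>\<in>space M. S k \<omega> \<in> B \<and> (\<forall>j\<in>{1..n}. \<epsilon> \<le> \<bar>S (k + j) \<omega> - S k \<omega>\<bar>)}"
    using W_E[of k] V_D by auto
  also note V_D
  finally show ?thesis .
qed

text \<open>A last-exit argument: two times at most \<open>n\<close> at which the walk sits in the same cell of mesh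
  \<open>\<epsilon>\<close> cannot both be followed by \<open>n\<close> steps that stay at distance \<open>\<epsilon>\<close>, so each of the
  \<open>2 * J + 1\<close> cells accounts for at most one such time.\<close>

lemma sum_prob_cells_mult_avoid_le:
  assumes n: "1 \<le> n" and \<epsilon>: "0 < \<epsilon>"
  shows "(\<Sum>k\<le>n. prob {\<omega>\<in>space M. \<bar>\<lfloor>S k \<omega> / \<epsilon>\<rfloor>\<bar> \<le> int J}) *
    prob {\<omega>\<in>space M. \<forall>j\<in>{1..n}. \<epsilon> \<le> \<bar>S j \<omega>\<bar>} \<le> 2 * real J + 1"
proof -
  define B where "B = {x::real. \<bar>\<lfloor>x / \<epsilon>\<rfloor>\<bar> \<le> int J}"
  define E where "E k = {\<omega>\<in>space M. S k \<omega> \<in> B \<and> (\<forall>j\<in>{1..n}. \<epsilon> \<le> \<bar>S (k + j) \<omega> - S k \<omega>\<bar>)}" for k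
  have "B = {x. - real J \<le> x / \<epsilon> \<and> x / \<epsilon> < real J + 1}"
    unfolding B_def by (intro Collect_cong) linarith
  then have B [measurable]: "B \<in> sets borel" by simp
  have E [measurable]: "E k \<in> sets M" for k unfolding E_def by measurable
  have "(\<Sum>k\<le>n. prob {\<omega>\<in>space M. S k \<omega> \<in> B}) * prob {\<omega>\<in>space M. \<forall>j\<in>{1..n}. \<epsilon> \<le> \<bar>S j \<omega>\<bar>} = (\<Sum>k\<le>n. prob (E k))"
    unfolding E_def sum_distrib_right by (intro sum.cong refl prob_avoid_shifted[OF n B, symmetric])
  also have "\<dots> = (\<Sum>k\<le>n. \<integral>\<omega>. indicator (E k) \<omega> \<partial>M)" by simp
  also have "\<dots> = (\<integral>\<omega>. (\<Sum>k\<le>n. indicator (E k) \<omega>) \<partial>M)"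
    by (subst Bochner_Integration.integral_sum) (auto simp: emeasure_eq_measure)
  also have "\<dots> \<le> (\<integral>\<omega>. 2 * real J + 1 \<partial>M)"
  proof (intro integral_mono)
    fix \<omega> assume "\<omega> \<in> space M"
    let ?K = "{k\<in>{..n}. \<omega> \<in> E k}"
    have sep: "\<lfloor>S k \<omega> / \<epsilon>\<rfloor> \<noteq> \<lfloor>S l \<omega> / \<epsilon>\<rfloor>" if "k \<in> ?K" "l \<in> ?K" "k < l" for k l
    proof
      assume "\<lfloor>S k \<omega> / \<epsilon>\<rfloor> = \<lfloor>S l \<omega> / \<epsilon>\<rfloor>"
      then have "\<bar>S l \<omega> / \<epsilon> - S k \<omega> / \<epsilon>\<bar> < 1" by linarith
      then have "\<bar>S l \<omega> - S k \<omega>\<bar> / \<epsilon> < 1" using \<epsilon> by (simp add: diff_divide_distrib[symmetric])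
      then have "\<bar>S l \<omega> - S k \<omega>\<bar> < \<epsilon>" using \<epsilon> by simp
      \<comment> \<open>Both times are at most \<open>n\<close>, so \<open>l - k\<close> lies
        between 1 and \<open>n\<close> and the avoidance recorded at \<open>k\<close> covers time
        \<open>l\<close>.\<close>
      moreover have "\<epsilon> \<le> \<bar>S (k + (l - k)) \<omega> - S k \<omega>\<bar>"
        using that by (intro bspec[of "{1..n}" "\<lambda>j. \<epsilon> \<le> \<bar>S (k + j) \<omega> - S k \<omega>\<bar>"]) (auto simp: E_def)
      ultimately show False using that by simp
    qed
    have "inj_on (\<lambda>k. \<lfloor>S k \<omega> / \<epsilon>\<rfloor>) ?K"
      using sep by (intro linorder_inj_onI) auto
    moreover have "(\<lambda>k. \<lfloor>S k \<omega> / \<epsilon>\<rfloor>) ` ?K \<subseteq> {- int J..int J}"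
      by (auto simp: E_def B_def)
    ultimately have "card ?K \<le> card {- int J..int J}" by (rule card_inj_on_le) simp
    then have "card ?K \<le> 2 * J + 1" by simp
    moreover have "(\<Sum>k\<le>n. indicator (E k) \<omega>) = real (card ?K)"
      by (simp add: indicator_def sum.If_cases Int_def)
    ultimately show "(\<Sum>k\<le>n. indicator (E k) \<omega>) \<le> 2 * real J + 1" by simp
  qed (auto simp: emeasure_eq_measure)
  also have "\<dots> = 2 * real J + 1" by (simp add: prob_space)
  finally show ?thesis by (simp add: B_def)
qed

end

section \<open>Walks attracted to a stable law\<close>

text \<open>Location and skewness enter only through the phase, also for \<alpha> equal to
  1.\<close>

lemma cmod_stable_char:
  assumes "0 < \<alpha>"
  shows "cmod (stable_char \<alpha> \<gamma> c b t) = exp (- c * \<bar>t\<bar> powr \<alpha>)"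
  by (cases "\<alpha> = 1") (auto simp: stable_char_def)

locale stable_walk = iid_walk M X S for M :: "'a measure" and X S +
  fixes A :: "nat \<Rightarrow> real" and \<mu> :: "real measure" and \<alpha> :: real
  assumes A_pos: "\<And>n. 0 < A n"
    and stable: "stable_law \<alpha> \<mu>"
    and conv: "weak_conv_m (\<lambda>n. distr M borel (\<lambda>\<omega>. S n \<omega> / A n)) \<mu>"
    and cramer: "Limsup at_infinity (\<lambda>t::real. ereal (cmod (char (distr M borel (X 0)) t))) < 1"
begin

sublocale step: real_distribution \<nu> by (rule real_distribution_step)

lemma \<alpha>_pos: "0 < \<alpha>"
  using stable by (simp add: stable_law_def)

lemma real_distribution_limit: "real_distribution \<mu>"
  using stable by (simp add: stable_law_def)

lemma stable_modulus_step: "\<exists>c. stable_modulus (\<lambda>t. cmod (char \<nu> t)) A c \<alpha>"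
proof -
  obtain \<gamma> c b where c: "0 < c" "\<And>t. char \<mu> t = stable_char \<alpha> \<gamma> c b t"
    using stable by (auto simp: stable_law_def)
  have "uniform_limit {-2..2} (\<lambda>n. char (distr M borel (\<lambda>\<omega>. S n \<omega> / A n))) (char \<mu>) sequentially"
    by (intro weak_conv_imp_char_uniform_limit real_distribution_limit conv real_distribution_distr) simp
  then have "uniform_limit {0..2} (\<lambda>n. char (distr M borel (\<lambda>\<omega>. S n \<omega> / A n))) (char \<mu>) sequentially"
    by (rule uniform_limit_on_subset) auto
  then have "uniform_limit {0..2} (\<lambda>n t. cmod (char (distr M borel (\<lambda>\<omega>. S n \<omega> / A n)) t)) (\<lambda>t. cmod (char \<mu> t)) sequentially"
    by (rule uniform_limit_norm)
  then have "uniform_limit {0..2} (\<lambda>n t. cmod (char \<nu> (t / A n)) ^ n) (\<lambda>t. cmod (char \<mu> t)) sequentially"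
    by (simp only: char_S_scaled norm_power)
  also have "?this \<longleftrightarrow> uniform_limit {0..2} (\<lambda>n t. cmod (char \<nu> (t / A n)) ^ n) (\<lambda>t. exp (- c * t powr \<alpha>)) sequentially"
    by (rule uniform_limit_cong') (auto simp: c cmod_stable_char \<alpha>_pos)
  finally have lim: "uniform_limit {0..2} (\<lambda>n t. cmod (char \<nu> (t / A n)) ^ n) (\<lambda>t. exp (- c * t powr \<alpha>)) sequentially" .
  show ?thesis
  proof (intro exI[of _ c], unfold_locales)
    show "\<exists>\<rho>>0. \<rho> < 1 \<and> (\<forall>t. \<delta> \<le> \<bar>t\<bar> \<longrightarrow> cmod (char \<nu> t) \<le> \<rho>)" if "0 < \<delta>" for \<delta>
      using step.cramer_away_from_0[OF cramer that] by metis
    show "isCont (\<lambda>t. cmod (char \<nu> t)) 0"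
      by (intro continuous_intros step.isCont_char)
  qed (use lim c step.cmod_char_le_1 step.char_zero A_pos \<alpha>_pos in auto)
qed

text \<open>Split the Gaussian average by the size of \<open>\<bar>s\<bar> / \<epsilon>\<close>. Up
  to \<open>n powr - r\<close> the integrand is at most 1 on a set of small Gaussian mass; beyond
  \<open>\<delta>\<close> it is at most \<open>\<rho> ^ n\<close>; in between it is at most
  \<open>exp (- \<kappa> * n powr (1 - r * p))\<close>. The error \<open>b\<close> does not involve
  \<epsilon>, so \<epsilon> may later depend on \<open>n\<close>.\<close>

lemma small_ball_bound:
  assumes r: "0 < r" "r < 1 / \<alpha>"
  shows "\<exists>b. summable b \<and> (\<forall>n \<epsilon>. 1 \<le> n \<longrightarrow> 0 < \<epsilon> \<longrightarrow>
    prob {\<omega>\<in>space M. \<bar>S n \<omega>\<bar> < \<epsilon>} \<le> 2 * \<epsilon> * real n powr - r + b n)"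
proof -
  obtain c where "stable_modulus (\<lambda>t. cmod (char \<nu> t)) A c \<alpha>" using stable_modulus_step by blast
  then interpret F: stable_modulus "\<lambda>t. cmod (char \<nu> t)" A c \<alpha> .
  interpret N: real_distribution std_normal_distribution by (rule real_dist_normal_dist)
  have "\<alpha> < 1 / r" using r \<alpha>_pos by (simp add: field_simps)
  \<comment> \<open>\<open>\<alpha> < p\<close> is what \<open>f_le_exp_powr\<close> requires, and
    \<open>p < 1 / r\<close> makes the stretched exponential summable.\<close>
  then obtain p where p: "\<alpha> < p" "p < 1 / r" using dense by blast
  have rp: "0 < 1 - r * p" using p r by (simp add: field_simps)
  obtain \<delta> \<kappa> where \<delta>: "0 < \<delta>" "0 < \<kappa>"
    "\<And>s. 0 < s \<Longrightarrow> s \<le> \<delta> \<Longrightarrow> cmod (char \<nu> s) \<le> exp (- \<kappa> * s powr p)"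
    using F.f_le_exp_powr[OF p(1)] by blast
  obtain \<rho> where \<rho>: "0 < \<rho>" "\<rho> < 1" "\<And>t. \<delta> \<le> \<bar>t\<bar> \<Longrightarrow> cmod (char \<nu> t) \<le> \<rho>"
    using F.f_away[OF \<delta>(1)] by auto
  define b where "b n = 2 * (\<rho> ^ n + exp (- \<kappa> * real n powr (1 - r * p)))" for n
  have "summable (\<lambda>n. exp (- \<kappa> * real n powr (1 - r * p)))"
  proof (rule summable_comparison_test_bigo)
    show "summable (\<lambda>n. norm (real n powr - 2))" by (simp add: summable_real_powr_iff)
    show "(\<lambda>n. exp (- \<kappa> * real n powr (1 - r * p))) \<in> O(\<lambda>n. real n powr - 2)"
      using rp \<delta>(2) by real_asymp
  qed
  then have "summable b"
    unfolding b_def using \<rho> by (intro summable_mult summable_add summable_geometric) auto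
  moreover have "prob {\<omega>\<in>space M. \<bar>S n \<omega>\<bar> < \<epsilon>} \<le> 2 * \<epsilon> * real n powr - r + b n"
    if n: "1 \<le> n" and \<epsilon>: "0 < \<epsilon>" for n \<epsilon>
  proof -
    define q where "q = \<rho> ^ n + exp (- \<kappa> * real n powr (1 - r * p))"
    define I where "I = {s. \<bar>s\<bar> \<le> \<epsilon> * real n powr - r}"
    have I: "I \<in> sets borel" unfolding I_def by simp
    have pointwise: "cmod (char \<nu> (s / \<epsilon>)) ^ n \<le> q + indicator I s" for s
    proof -
      have ev: "cmod (char \<nu> (s / \<epsilon>)) = cmod (char \<nu> (\<bar>s\<bar> / \<epsilon>))"
        using step.cmod_char_minus[of "s / \<epsilon>"] by (cases "0 \<le> s") auto
      consider "s \<in> I" | "s \<notin> I" "\<delta> \<le> \<bar>s\<bar> / \<epsilon>" | "s \<notin> I" "\<bar>s\<bar> / \<epsilon> < \<delta>" by linarith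
      then show ?thesis
      proof cases
        case 1
        have "cmod (char \<nu> (s / \<epsilon>)) ^ n \<le> 1" by (intro power_le_one step.cmod_char_le_1) simp
        moreover have "0 \<le> q" using \<rho> by (simp add: q_def)
        ultimately show ?thesis using 1 by simp
      next
        case 2
        have "cmod (char \<nu> (\<bar>s\<bar> / \<epsilon>)) ^ n \<le> \<rho> ^ n"
          using 2 \<epsilon> by (intro power_mono \<rho>(3)) auto
        then show ?thesis using 2 by (simp add: ev q_def add_increasing2)
      next
        case 3
        have big: "real n powr - r \<le> \<bar>s\<bar> / \<epsilon>" using 3 \<epsilon> by (simp add: I_def field_simps)
        have pos: "0 < \<bar>s\<bar> / \<epsilon>" by (rule less_le_trans[OF _ big]) (use n in simp)
        have "cmod (char \<nu> (\<bar>s\<bar> / \<epsilon>)) ^ n \<le> exp (- \<kappa> * (\<bar>s\<bar> / \<epsilon>) powr p) ^ n"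
          using 3 pos by (intro power_mono \<delta>(3)) auto
        also have "\<dots> = exp (real n * (- \<kappa> * (\<bar>s\<bar> / \<epsilon>) powr p))"
          by (rule exp_of_nat_mult[symmetric])
        also have "\<dots> \<le> exp (- \<kappa> * real n powr (1 - r * p))"
        proof -
          have "real n powr (1 - r * p) = real n powr 1 * (real n powr - r) powr p"
            by (simp only: powr_powr powr_add[symmetric]) simp
          also have "\<dots> \<le> real n * (\<bar>s\<bar> / \<epsilon>) powr p"
            using big p \<alpha>_pos by (simp add: mult_left_mono powr_mono2)
          finally show ?thesis using \<delta>(2) by (simp add: mult.left_commute mult_left_mono)
        qed
        finally show ?thesis using 3 \<rho> by (simp add: ev q_def add_increasing)
      qed
    qed
    have meas: "(\<lambda>s. cmod (char \<nu> (s / \<epsilon>)) ^ n) \<in> borel_measurable std_normal_distribution"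
      by (intro borel_measurable_power borel_measurable_norm) (use step.char_measurable in measurable)
    have "(\<integral>s. cmod (char \<nu> (s / \<epsilon>)) ^ n \<partial>std_normal_distribution) \<le> (\<integral>s. q + indicator I s \<partial>std_normal_distribution)"
    proof (intro integral_mono pointwise)
      show "integrable std_normal_distribution (\<lambda>s. cmod (char \<nu> (s / \<epsilon>)) ^ n)"
        using meas by (intro N.integrable_const_bound[of _ 1]) (auto intro!: power_le_one step.cmod_char_le_1)
      show "integrable std_normal_distribution (\<lambda>s. q + indicator I s)"
        using I by (auto intro!: integrable_real_indicator simp: N.emeasure_eq_measure)
    qed
    also have "\<dots> = q + measure std_normal_distribution I"
      using I N.prob_space
      by (subst Bochner_Integration.integral_add) (auto intro!: integrable_real_indicator simp: N.emeasure_eq_measure)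
    also have "measure std_normal_distribution I \<le> \<epsilon> * real n powr - r"
      unfolding I_def using \<epsilon> by (intro std_normal_measure_abs_le) simp
    finally have "2 * (\<integral>s. cmod (char \<nu> (s / \<epsilon>)) ^ n \<partial>std_normal_distribution) \<le> 2 * \<epsilon> * real n powr - r + b n"
      by (simp add: b_def q_def)
    with small_ball_S_le[OF \<epsilon>, of n] show ?thesis by simp
  qed
  ultimately show ?thesis by blast
qed

text \<open>With \<epsilon> equal to \<open>n powr - \<theta>\<close> the small-ball bound is of
  order \<open>n powr - (\<theta> + r)\<close>, summable once \<open>1 - \<theta> < r\<close>; such
  an \<open>r\<close> exists below \<open>1 / \<alpha>\<close>.\<close>

lemma AE_eventually_abs_S_ge:
  assumes \<theta>: "1 - 1 / \<alpha> < \<theta>"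
  shows "AE \<omega> in M. eventually (\<lambda>n. real n powr - \<theta> \<le> \<bar>S n \<omega>\<bar>) sequentially"
proof -
  \<comment> \<open>The maximum keeps \<open>r\<close> positive when \<open>\<theta>\<close> is 1 or
    more.\<close>
  have "max 0 (1 - \<theta>) < 1 / \<alpha>" using \<theta> \<alpha>_pos by (simp add: max_def)
  then obtain r where r: "max 0 (1 - \<theta>) < r" "r < 1 / \<alpha>" using dense by blast
  obtain b where b: "summable b"
    "\<And>n \<epsilon>. 1 \<le> n \<Longrightarrow> 0 < \<epsilon> \<Longrightarrow> prob {\<omega>\<in>space M. \<bar>S n \<omega>\<bar> < \<epsilon>} \<le> 2 * \<epsilon> * real n powr - r + b n"
    using small_ball_bound[of r] r by auto
  let ?E = "\<lambda>n. {\<omega>\<in>space M. \<bar>S n \<omega>\<bar> < real n powr - \<theta>}"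
  have "summable (\<lambda>n. prob (?E n))"
  proof (rule summable_comparison_test')
    show "summable (\<lambda>n. 2 * real n powr - (\<theta> + r) + b n)"
      using r b(1) by (intro summable_add summable_mult) (simp_all add: summable_real_powr_iff)
    show "norm (prob (?E n)) \<le> 2 * real n powr - (\<theta> + r) + b n" if "1 \<le> n" for n
      using b(2)[of n "real n powr - \<theta>"] that by (simp add: powr_add[symmetric] mult.assoc)
  qed
  then have "AE \<omega> in M. eventually (\<lambda>n. \<omega> \<in> space M - ?E n) sequentially"
    by (intro borel_cantelli_AE1) (auto simp: emeasure_eq_measure)
  then show ?thesis
    by (rule AE_mp) (auto intro!: AE_I2 elim!: eventually_mono)
qed

text \<open>After division by \<open>A n\<close> the threshold becomes
  \<open>n powr p / A n\<close>, which diverges because \<open>A n \<le> n powr q\<close> eventually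
  for some \<open>q < p\<close>; tightness then applies.\<close>

lemma prob_abs_S_le_powr:
  assumes p: "1 / \<alpha> < p"
  shows "(\<lambda>n. prob {\<omega>\<in>space M. \<bar>S n \<omega>\<bar> \<le> real n powr p}) \<longlonglongrightarrow> 1"
proof -
  obtain c where "stable_modulus (\<lambda>t. cmod (char \<nu> t)) A c \<alpha>" using stable_modulus_step by blast
  then interpret F: stable_modulus "\<lambda>t. cmod (char \<nu> t)" A c \<alpha> .
  obtain q where q: "1 / \<alpha> < q" "q < p" using p dense by blast
  have lim: "filterlim (\<lambda>n. real n powr p / A n) at_top sequentially"
  proof (rule filterlim_at_top_mono)
    show "filterlim (\<lambda>n. real n powr (p - q)) at_top sequentially"
    proof -
      have "0 < p - q" using q by simp
      then show ?thesis by real_asymp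
    qed
    show "eventually (\<lambda>n. real n powr (p - q) \<le> real n powr p / A n) sequentially"
      using F.a_le_powr[OF q(1)] eventually_gt_at_top[of 0]
    proof eventually_elim
      case (elim n)
      have "real n powr (p - q) = real n powr p / real n powr q" by (simp add: powr_diff)
      also have "\<dots> \<le> real n powr p / A n" using elim A_pos[of n] by (intro divide_left_mono) auto
      finally show ?case .
    qed
  qed
  have "(\<lambda>n. measure (distr M borel (\<lambda>\<omega>. S n \<omega> / A n)) {x. \<bar>x\<bar> \<le> real n powr p / A n}) \<longlonglongrightarrow> 1"
    by (intro weak_conv_imp_prob_abs_le_tendsto_1[OF _ real_distribution_limit conv lim] real_distribution_distr) simp
  moreover have "measure (distr M borel (\<lambda>\<omega>. S n \<omega> / A n)) {x. \<bar>x\<bar> \<le> real n powr p / A n}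
      = prob {\<omega>\<in>space M. \<bar>S n \<omega>\<bar> \<le> real n powr p}" for n
    using A_pos[of n]
    by (subst measure_distr) (auto intro!: arg_cong[where f = prob] simp: divide_le_cancel)
  ultimately show ?thesis by simp
qed

text \<open>Most times up to \<open>n\<close> find the walk, with probability at least 1/2, in the
  cells within \<open>n powr p\<close> of 0, and there are about
  \<open>n powr (p + \<theta>)\<close> such cells. The last-exit bound then forces the avoidance
  probability to be small.\<close>

lemma prob_avoid_le:
  assumes p: "1 / \<alpha> < p" and \<theta>: "0 < \<theta>"
  shows "eventually (\<lambda>n. prob {\<omega>\<in>space M. \<forall>j\<in>{1..n}. real n powr - \<theta> \<le> \<bar>S j \<omega>\<bar>}
    \<le> 20 * real n powr (p + \<theta> - 1)) sequentially"
proof -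
  have p0: "0 < p" using p \<alpha>_pos by (meson less_trans zero_less_divide_1_iff)
  have "eventually (\<lambda>k. 1 / 2 < prob {\<omega>\<in>space M. \<bar>S k \<omega>\<bar> \<le> real k powr p}) sequentially"
    using prob_abs_S_le_powr[OF p] by (rule order_tendstoD) simp
  then obtain k0 where k0: "\<And>k. k0 \<le> k \<Longrightarrow> 1 / 2 < prob {\<omega>\<in>space M. \<bar>S k \<omega>\<bar> \<le> real k powr p}"
    by (auto simp: eventually_sequentially)
  show ?thesis
    using eventually_ge_at_top[of "max 1 (2 * k0)"]
  proof eventually_elim
    case (elim n)
    then have n: "1 \<le> n" "2 * k0 \<le> n" by auto
    define \<epsilon> where "\<epsilon> = real n powr - \<theta>"
    define J where "J = nat \<lceil>real n powr (p + \<theta>)\<rceil>"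
    let ?a = "prob {\<omega>\<in>space M. \<forall>j\<in>{1..n}. \<epsilon> \<le> \<bar>S j \<omega>\<bar>}"
    have \<epsilon>: "0 < \<epsilon>" using n by (simp add: \<epsilon>_def)
    have one: "1 \<le> real n powr (p + \<theta>)" using n p0 \<theta> by (intro ge_one_powr_ge_zero) auto
    then have J: "real J \<le> real n powr (p + \<theta>) + 1" unfolding J_def by linarith
    have cell: "1 / 2 \<le> prob {\<omega>\<in>space M. \<bar>\<lfloor>S k \<omega> / \<epsilon>\<rfloor>\<bar> \<le> int J}" if k: "k0 \<le> k" "k \<le> n" for k
    proof -
      have "1 / 2 \<le> prob {\<omega>\<in>space M. \<bar>S k \<omega>\<bar> \<le> real k powr p}" using k0[OF k(1)] by simp
      also have "\<dots> \<le> prob {\<omega>\<in>space M. \<bar>\<lfloor>S k \<omega> / \<epsilon>\<rfloor>\<bar> \<le> int J}"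
      proof (rule finite_measure_mono)
        show "{\<omega>\<in>space M. \<bar>S k \<omega>\<bar> \<le> real k powr p} \<subseteq> {\<omega>\<in>space M. \<bar>\<lfloor>S k \<omega> / \<epsilon>\<rfloor>\<bar> \<le> int J}"
        proof safe
          fix \<omega> assume "\<bar>S k \<omega>\<bar> \<le> real k powr p"
          also have "\<dots> \<le> real n powr p" using k p0 by (intro powr_mono2) auto
          finally have "\<bar>S k \<omega>\<bar> / \<epsilon> \<le> real n powr p / \<epsilon>" using \<epsilon> by (intro divide_right_mono) auto
          also have "\<dots> = real n powr (p + \<theta>)" by (simp add: \<epsilon>_def powr_diff[symmetric])
          also have "\<dots> \<le> real J" unfolding J_def by linarith
          finally have "\<bar>S k \<omega> / \<epsilon>\<bar> \<le> real J" using \<epsilon> by simp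
          then show "\<bar>\<lfloor>S k \<omega> / \<epsilon>\<rfloor>\<bar> \<le> int J" by linarith
        qed
        have "{\<omega>\<in>space M. \<bar>\<lfloor>S k \<omega> / \<epsilon>\<rfloor>\<bar> \<le> int J} = {\<omega>\<in>space M. - real J \<le> S k \<omega> / \<epsilon> \<and> S k \<omega> / \<epsilon> < real J + 1}"
          by (intro Collect_cong conj_cong refl) linarith
        also have "\<dots> \<in> events" by measurable
        finally show "{\<omega>\<in>space M. \<bar>\<lfloor>S k \<omega> / \<epsilon>\<rfloor>\<bar> \<le> int J} \<in> events" .
      qed
      finally show ?thesis .
    qed
    \<comment> \<open>At least half of the times up to \<open>n\<close> are past \<open>k0\<close>,
      each contributing 1/2. With \<open>2 * J + 1\<close> at most 5 times the power, this is the
      source of the constant 20.\<close>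
    have "real n / 4 \<le> real (card {k0..n}) * (1 / 2)" using n by (simp add: of_nat_diff)
    also have "\<dots> \<le> (\<Sum>k\<in>{k0..n}. prob {\<omega>\<in>space M. \<bar>\<lfloor>S k \<omega> / \<epsilon>\<rfloor>\<bar> \<le> int J})"
      using cell by (intro sum_bounded_below) auto
    also have "\<dots> \<le> (\<Sum>k\<le>n. prob {\<omega>\<in>space M. \<bar>\<lfloor>S k \<omega> / \<epsilon>\<rfloor>\<bar> \<le> int J})"
      by (intro sum_mono2) auto
    finally have "real n / 4 * ?a \<le> (\<Sum>k\<le>n. prob {\<omega>\<in>space M. \<bar>\<lfloor>S k \<omega> / \<epsilon>\<rfloor>\<bar> \<le> int J}) * ?a"
      by (intro mult_right_mono) auto
    also have "\<dots> \<le> 2 * real J + 1" by (rule sum_prob_cells_mult_avoid_le[OF n(1) \<epsilon>])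
    also have "\<dots> \<le> 5 * real n powr (p + \<theta>)" using J one by linarith
    finally have "?a \<le> 20 * (real n powr (p + \<theta>) / real n powr 1)" using n by (simp add: field_simps)
    then show ?case by (simp only: \<epsilon>_def powr_diff)
  qed
qed

text \<open>The bound of \<open>prob_avoid_le\<close> is not summable over all \<open>n\<close>, but
  along powers of two it is geometric with ratio \<open>2 powr (p + \<theta> - 1)\<close>, below 1
  by the choice of \<open>p\<close>.\<close>

lemma AE_eventually_hit:
  assumes \<theta>: "0 < \<theta>" "\<theta> < 1 - 1 / \<alpha>"
  shows "AE \<omega> in M. eventually (\<lambda>i. \<exists>j\<in>{1..2 ^ i}. \<bar>S j \<omega>\<bar> < (2 ^ i) powr - \<theta>) sequentially"
proof -
  have "1 / \<alpha> < 1 - \<theta>" using \<theta> by simp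
  then obtain p where p: "1 / \<alpha> < p" "p < 1 - \<theta>" using dense by blast
  let ?E = "\<lambda>i. {\<omega>\<in>space M. \<forall>j\<in>{1..2 ^ i}. real (2 ^ i) powr - \<theta> \<le> \<bar>S j \<omega>\<bar>}"
  have pw: "filterlim (\<lambda>i. 2 ^ i :: nat) at_top sequentially"
    by (rule filterlim_subseq) (simp add: strict_mono_def)
  have "summable (\<lambda>i. prob (?E i))"
  proof (rule summable_comparison_test_ev)
    show "eventually (\<lambda>i. norm (prob (?E i)) \<le> 20 * (2 powr (p + \<theta> - 1)) ^ i) sequentially"
      using eventually_compose_filterlim[OF prob_avoid_le[OF p(1) \<theta>(1)] pw]
    proof eventually_elim
      case (elim i)
      have "real (2 ^ i) powr (p + \<theta> - 1) = (2 powr (p + \<theta> - 1)) ^ i"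
        by (simp add: powr_realpow[symmetric] powr_powr mult.commute)
      with elim show ?case by simp
    qed
    have "2 powr (p + \<theta> - 1) < 2 powr (0::real)" using p by (intro powr_less_mono) auto
    then show "summable (\<lambda>i. 20 * (2 powr (p + \<theta> - 1)) ^ i)"
      by (intro summable_mult summable_geometric) simp
  qed
  then have "AE \<omega> in M. eventually (\<lambda>i. \<omega> \<in> space M - ?E i) sequentially"
    by (intro borel_cantelli_AE1) (auto simp: emeasure_eq_measure)
  then show ?thesis
    by (rule AE_mp) (auto intro!: AE_I2 elim!: eventually_mono simp: not_le)
qed

end

section \<open>Hitting times\<close>

lemma hit_time_props:
  assumes "\<exists>n\<ge>1. \<bar>S n \<omega>\<bar> < \<epsilon>"
  shows "1 \<le> hit_time S \<epsilon> \<omega>" and "\<bar>S (hit_time S \<epsilon> \<omega>) \<omega>\<bar> < \<epsilon>"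
  using LeastI_ex[OF assms] by (auto simp: hit_time_def)

lemma hit_time_le:
  assumes "1 \<le> n" "\<bar>S n \<omega>\<bar> < \<epsilon>"
  shows "hit_time S \<epsilon> \<omega> \<le> n"
  unfolding hit_time_def using assms by (intro Least_le) simp

text \<open>Finitely many nonzero early values leave a positive minimum, so for smaller \<epsilon>
  the hit occurs after \<open>N\<close>, where \<open>\<tau> powr - \<theta> \<le> \<bar>S \<tau>
  \<omega>\<bar> < \<epsilon>\<close>. Dividing by the negative \<open>ln \<epsilon>\<close>
  reverses the inequality.\<close>

lemma eventually_hit_exponent_le:
  assumes \<theta>: "0 < \<theta>"
    and far: "eventually (\<lambda>n. real n powr - \<theta> \<le> \<bar>S n \<omega>\<bar>) sequentially"
    and nz: "\<forall>n\<ge>1. S n \<omega> \<noteq> 0"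
    and hit: "\<And>\<epsilon>. 0 < \<epsilon> \<Longrightarrow> \<exists>n\<ge>1. \<bar>S n \<omega>\<bar> < \<epsilon>"
  shows "eventually (\<lambda>\<epsilon>. ln (real (hit_time S \<epsilon> \<omega>)) / ln \<epsilon> \<le> - 1 / \<theta>) (at_right 0)"
proof -
  obtain N where N: "\<And>n. N \<le> n \<Longrightarrow> real n powr - \<theta> \<le> \<bar>S n \<omega>\<bar>"
    using far by (auto simp: eventually_sequentially)
  \<comment> \<open>Inserting 1 keeps the set nonempty for \<open>N = 0\<close> and gives
    \<open>m \<le> 1\<close>, hence \<open>ln \<epsilon> < 0\<close>.\<close>
  define m where "m = Min (insert 1 ((\<lambda>n. \<bar>S n \<omega>\<bar>) ` {1..N}))"
  have m: "0 < m" using nz by (auto simp: m_def)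
  have m_le: "m \<le> \<bar>S n \<omega>\<bar>" if "1 \<le> n" "n \<le> N" for n
    unfolding m_def using that by (intro Min_le) auto
  have m1: "m \<le> 1" by (auto simp: m_def)
  have "eventually (\<lambda>\<epsilon>. \<epsilon> \<in> {0<..<m}) (at_right 0)"
    using m by (rule eventually_at_right_real)
  then show ?thesis
  proof eventually_elim
    case (elim \<epsilon>)
    then have \<epsilon>: "0 < \<epsilon>" "\<epsilon> < m" by auto
    define \<tau> where "\<tau> = hit_time S \<epsilon> \<omega>"
    have \<tau>: "1 \<le> \<tau>" "\<bar>S \<tau> \<omega>\<bar> < \<epsilon>" using hit_time_props[of S \<omega> \<epsilon>, OF hit[OF \<epsilon>(1)]] by (auto simp: \<tau>_def)
    have "N < \<tau>" using m_le[of \<tau>] \<tau> \<epsilon> by force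
    then have "real \<tau> powr - \<theta> < \<epsilon>" using N[of \<tau>] \<tau> by simp
    then have "ln (real \<tau> powr - \<theta>) < ln \<epsilon>" using \<epsilon>(1) \<tau>(1) by (subst ln_less_cancel_iff) auto
    then have "- ln \<epsilon> < \<theta> * ln (real \<tau>)" using \<tau>(1) by (simp add: ln_powr)
    moreover have "ln \<epsilon> < 0" using \<epsilon> m1 by simp
    ultimately show ?case using \<theta> by (simp add: \<tau>_def[symmetric] field_simps)
  qed
qed

text \<open>Choose the dyadic time \<open>2 ^ i\<close> at which
  \<open>(2 ^ i) powr - \<theta>\<close> first drops to \<epsilon> or below. Rounding
  \<open>i\<close> up costs at most \<open>ln 2\<close> in the logarithm of the hitting time, which
  \<open>e\<close> absorbs as \<epsilon> tends to 0.\<close>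

lemma eventually_hit_exponent_ge:
  assumes \<theta>: "0 < \<theta>" and e: "0 < e"
    and near: "eventually (\<lambda>i. \<exists>j\<in>{1..2 ^ i}. \<bar>S j \<omega>\<bar> < (2 ^ i) powr - \<theta>) sequentially"
  shows "eventually (\<lambda>\<epsilon>. - 1 / \<theta> - e \<le> ln (real (hit_time S \<epsilon> \<omega>)) / ln \<epsilon>) (at_right 0)"
proof -
  obtain N where N: "\<And>i. N \<le> i \<Longrightarrow> \<exists>j\<in>{1..2 ^ i}. \<bar>S j \<omega>\<bar> < (2 ^ i) powr - \<theta>"
    using near by (auto simp: eventually_sequentially)
  \<comment> \<open>This makes the dyadic index at least \<open>N\<close>; the next condition gives
    \<open>ln 2 < e * - ln \<epsilon>\<close>.\<close>
  have "eventually (\<lambda>\<epsilon>::real. real N < - log 2 \<epsilon> / \<theta>) (at_right 0)" using \<theta> by real_asymp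
  moreover have "eventually (\<lambda>\<epsilon>::real. ln 2 / e < - ln \<epsilon>) (at_right 0)" by real_asymp
  moreover have "eventually (\<lambda>\<epsilon>. \<epsilon> \<in> {0<..<1::real}) (at_right 0)"
    by (rule eventually_at_right_real) simp
  ultimately show ?thesis
  proof eventually_elim
    case (elim \<epsilon>)
    then have \<epsilon>: "0 < \<epsilon>" "\<epsilon> < 1" by auto
    have ln\<epsilon>: "ln \<epsilon> < 0" using \<epsilon> by simp
    define i where "i = nat \<lceil>- log 2 \<epsilon> / \<theta>\<rceil>"
    have i: "- log 2 \<epsilon> / \<theta> \<le> real i" "real i \<le> - log 2 \<epsilon> / \<theta> + 1" "N \<le> i"
      using elim(1) unfolding i_def by linarith+
    obtain j where j: "1 \<le> j" "j \<le> 2 ^ i" "\<bar>S j \<omega>\<bar> < (2 ^ i) powr - \<theta>"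
      using N[OF i(3)] by auto
    have "(2 ^ i) powr - \<theta> = 2 powr (- \<theta> * real i)"
      by (simp add: powr_realpow[symmetric] powr_powr mult.commute)
    also have "\<dots> \<le> 2 powr (log 2 \<epsilon>)"
      using i(1) \<theta> by (intro powr_mono) (auto simp: field_simps)
    also have "\<dots> = \<epsilon>" using \<epsilon> by simp
    finally have lt: "\<bar>S j \<omega>\<bar> < \<epsilon>" using j(3) by simp
    define \<tau> where "\<tau> = hit_time S \<epsilon> \<omega>"
    have "1 \<le> \<tau>" using hit_time_props(1)[of S \<omega> \<epsilon>] j(1) lt unfolding \<tau>_def by blast
    moreover have "\<tau> \<le> 2 ^ i" using hit_time_le[of j S \<omega> \<epsilon>, OF j(1) lt] j(2) by (simp add: \<tau>_def)
    ultimately have "ln (real \<tau>) \<le> ln (real (2 ^ i))"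
      by (subst ln_le_cancel_iff) (auto simp del: of_nat_power)
    also have "\<dots> = real i * ln 2" by (simp add: ln_realpow)
    also have "\<dots> \<le> (- log 2 \<epsilon> / \<theta> + 1) * ln 2" using i(2) by (intro mult_right_mono) auto
    also have "\<dots> = - ln \<epsilon> / \<theta> + ln 2" by (simp add: log_def field_simps)
    also have "\<dots> \<le> - ln \<epsilon> / \<theta> + e * - ln \<epsilon>" using elim(2) e by (simp add: field_simps)
    finally have "ln (real \<tau>) \<le> (- 1 / \<theta> - e) * ln \<epsilon>" by (simp add: algebra_simps)
    then show ?case using ln\<epsilon> by (simp add: \<tau>_def[symmetric] neg_le_divide_eq)
  qed
qed

lemma (in stable_walk) \<alpha>_ge_1_if_recurrent:
  assumes "walk_recurrent M S"
  shows "1 \<le> \<alpha>"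
proof (rule ccontr)
  assume "\<not> 1 \<le> \<alpha>"
  then have "1 - 1 / \<alpha> < 0" using \<alpha>_pos by (simp add: field_simps)
  from AE_eventually_abs_S_ge[OF this] assms
  have "AE \<omega> in M. False"
    unfolding walk_recurrent_def
  proof eventually_elim
    case (elim \<omega>)
    have "frequently (\<lambda>n. \<bar>S n \<omega>\<bar> < 1) sequentially"
      using elim(2) by (simp add: cofinite_eq_sequentially)
    \<comment> \<open>Index 0 is excluded because \<open>0 powr 0\<close> is 0, not 1.\<close>
    moreover have "eventually (\<lambda>n. \<not> \<bar>S n \<omega>\<bar> < 1) sequentially"
      using elim(1) eventually_gt_at_top[of 0] by eventually_elim simp
    ultimately show False by (simp add: frequently_def)
  qed
  then show False by simp
qed

section \<open>Almost sure limit of the hitting exponent\<close>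

theorem theorem1p1:
  fixes M :: "'a measure" and X :: "nat \<Rightarrow> 'a \<Rightarrow> real"
    and S :: "nat \<Rightarrow> 'a \<Rightarrow> real" and A :: "nat \<Rightarrow> real"
    and \<mu> :: "real measure" and \<alpha> :: real
  assumes "prob_space M"
    and "\<And>i. X i \<in> borel_measurable M"
    and "prob_space.indep_vars M (\<lambda>_. borel) X UNIV"
    and "\<And>i. distr M borel (X i) = distr M borel (X 0)"
    and "\<And>n. S n = (\<lambda>\<omega>. \<Sum>i<n. X i \<omega>)"
    and "walk_recurrent M S"
    and "\<And>n. 0 < A n"
    and "stable_law \<alpha> \<mu>"
    and "weak_conv_m (\<lambda>n. distr M borel (\<lambda>\<omega>. S n \<omega> / A n)) \<mu>"
    and "Limsup at_infinity (\<lambda>t::real. ereal (cmod (char (distr M borel (X 0)) t))) < 1"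
  shows "AE \<omega> in M. (\<forall>n\<ge>1. S n \<omega> \<noteq> 0) \<longrightarrow>
           ((\<lambda>\<epsilon>. ereal (ln (real (hit_time S \<epsilon> \<omega>)) / ln \<epsilon>)) \<longlongrightarrow> - conj_exp \<alpha>) (at_right 0)"
proof -
  interpret prob_space M by fact
  interpret stable_walk M X S A \<mu> \<alpha> by unfold_locales (fact assms)+
  define b where "b = 1 - 1 / \<alpha>"
  have \<alpha>1: "1 \<le> \<alpha>" using assms(6) by (rule \<alpha>_ge_1_if_recurrent)
  then have b: "0 \<le> b" by (simp add: b_def field_simps)
  \<comment> \<open>Restricting to rational exponents leaves countably many null sets, so one null
    set serves all of them.\<close>
  have lower: "AE \<omega> in M. \<forall>q::rat. b < of_rat q \<longrightarrow>
      eventually (\<lambda>n. real n powr - of_rat q \<le> \<bar>S n \<omega>\<bar>) sequentially"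
    unfolding AE_all_countable b_def using AE_eventually_abs_S_ge by simp
  have upper: "AE \<omega> in M. \<forall>q::rat. 0 < q \<longrightarrow> of_rat q < b \<longrightarrow>
      eventually (\<lambda>i. \<exists>j\<in>{1..2 ^ i}. \<bar>S j \<omega>\<bar> < (2 ^ i) powr - of_rat q) sequentially"
    unfolding AE_all_countable b_def using AE_eventually_hit by simp
  show ?thesis
    using lower upper assms(6)[unfolded walk_recurrent_def]
  proof eventually_elim
    case (elim \<omega>)
    show ?case
    proof
      assume nz: "\<forall>n\<ge>1. S n \<omega> \<noteq> 0"
      let ?h = "\<lambda>\<epsilon>. ln (real (hit_time S \<epsilon> \<omega>)) / ln \<epsilon>"
      have hit: "\<exists>n\<ge>1. \<bar>S n \<omega>\<bar> < \<epsilon>" if "0 < \<epsilon>" for \<epsilon>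
        using elim(3) that unfolding INFM_nat by (metis Suc_leI One_nat_def)
      \<comment> \<open>For \<open>b = 0\<close> the premise is vacuous, so every \<open>u\<close>
        is allowed; this is divergence to minus infinity.\<close>
      have le: "eventually (\<lambda>\<epsilon>. ?h \<epsilon> < u) (at_right 0)" if u: "0 < b \<Longrightarrow> - 1 / b < u" for u
      proof -
        \<comment> \<open>For negative \<open>u\<close> the goal \<open>- 1 / q < u\<close> means
          \<open>q < - 1 / u\<close>. For other \<open>u\<close> every positive \<open>q\<close>
          works, and \<open>b + 1\<close> is merely a cap.\<close>
        have "b < (if u < 0 then - 1 / u else b + 1)"
          using u b by (cases "b = 0") (auto simp: field_simps)
        then obtain q where q: "b < of_rat q" "of_rat q < (if u < 0 then - 1 / u else b + 1)"
          using of_rat_dense by blast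
        have q0: "0 < real_of_rat q" using b q(1) by (rule le_less_trans)
        have "- 1 / of_rat q < u"
        proof (cases "u < 0")
          case True
          then show ?thesis using q(2) q0 by (simp add: field_simps)
        next
          case False
          moreover have "- 1 / real_of_rat q < 0" using q0 by simp
          ultimately show ?thesis by linarith
        qed
        moreover have "eventually (\<lambda>\<epsilon>. ?h \<epsilon> \<le> - 1 / of_rat q) (at_right 0)"
          using elim(1) q by (intro eventually_hit_exponent_le q0 nz hit) auto
        ultimately show ?thesis by (auto elim: eventually_mono)
      qed
      show "((\<lambda>\<epsilon>. ereal (?h \<epsilon>)) \<longlongrightarrow> - conj_exp \<alpha>) (at_right 0)"
      proof (cases "\<alpha> = 1")
        case True
        then have "b = 0" by (simp add: b_def)
        then show ?thesis using True le by (simp add: conj_exp_def tendsto_MInfty)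
      next
        case False
        then have b0: "0 < b" using \<alpha>1 by (simp add: b_def)
        have "(?h \<longlongrightarrow> - 1 / b) (at_right 0)"
        proof (rule order_tendstoI)
          fix l assume l: "l < - 1 / b"
          have l0: "l < 0" by (rule less_trans[OF l]) (use b0 in simp)
          have "- 1 / l < b" using l l0 b0 by (simp add: field_simps)
          then obtain q where q: "- 1 / l < of_rat q" "of_rat q < b" using of_rat_dense by blast
          have q0: "0 < real_of_rat q" by (rule less_trans[OF _ q(1)]) (use l0 in \<open>simp add: divide_neg_neg\<close>)
          \<comment> \<open>Half the distance from \<open>l\<close> to \<open>- 1 / q\<close>, so
            that \<open>- 1 / q - e\<close> still exceeds \<open>l\<close>.\<close>
          define e where "e = (- 1 / of_rat q - l) / 2"
          have e: "0 < e" using q(1) q0 l0 by (simp add: e_def field_simps)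
          have "eventually (\<lambda>\<epsilon>. - 1 / of_rat q - e \<le> ?h \<epsilon>) (at_right 0)"
            using elim(2) q q0 by (intro eventually_hit_exponent_ge q0 e) auto
          moreover have "l < - 1 / of_rat q - e"
          proof -
            have eq: "- 1 / of_rat q = l + 2 * e" using q0 by (simp add: e_def field_simps)
            show ?thesis unfolding eq using e by simp
          qed
          ultimately show "eventually (\<lambda>\<epsilon>. l < ?h \<epsilon>) (at_right 0)" by (auto elim: eventually_mono)
        qed (rule le)
        then have "((\<lambda>\<epsilon>. ereal (?h \<epsilon>)) \<longlongrightarrow> ereal (- 1 / b)) (at_right 0)" by simp
        also have "ereal (- 1 / b) = - conj_exp \<alpha>"
          using False \<alpha>1 by (simp add: conj_exp_def b_def field_simps)
        finally show ?thesis .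
      qed
    qed
  qed
qed

end
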